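(* Suppose the ODE $p^3+A(x,y)p+B(x,y)=0$, $p=\frac{dy}{dx}$, with $A,B$ holomorphic, has a flat web of solutions and admits a symmetry operator $X=\xi(x,y)\partial_x+\eta(x,y)\partial_y$ such that $C\ne0$ in the equality $X(u_i)=Cu_i+c_i$, $i=1,2,3$, where $u_i$ are the abelian first integrals and $C,c_i$ are constants. Then one can choose germs $I_i$, $i=1,2,3$, of first integrals of the ODE (at a point outside the discriminant curve) satisfying $I_i=k^2U_i$, where $dk=-k\gamma$, $\gamma$ is the Chern connection form, and $U_1,U_2,U_3$ are the roots of the cubic equation $$U^3-2\alpha U^2+\alpha^2U+\beta=0,$$ where $$\alpha=\xi^2A^2-3\eta^2A-9\xi\eta B,\qquad \beta=(4A^3+27B^2)(\eta^3+\xi^2\eta A+\xi^3B)^2.$$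
   Context: The discriminant curve is $\Delta=\{4A^3+27B^2=0\}$, with $4A^3+27B^2\not\equiv0$; outside it the equation has three distinct roots $p_1,p_2,p_3$ and its solutions form a 3-web of three pairwise transverse foliations. The web is flat (hexagonal) if near each point outside $\Delta$ there is a local biholomorphism mapping the solutions to three families of parallel lines. A symmetry is a holomorphic vector field, not identically zero, whose local flow maps web leaves to web leaves. Chern connection: $\sigma_1=(p_2-p_3)(dy-p_1dx)$, $\sigma_2=(p_3-p_1)(dy-p_2dx)$, $\sigma_3=(p_1-p_2)(dy-p_3dx)$; $\Omega=\sigma_1\wedge\sigma_2=\sigma_2\wedge\sigma_3=\sigma_3\wedge\sigma_1$; $d\sigma_i=h_i\Omega$; $\gamma=h_2\sigma_1-h_1\sigma_2$. For a flat web $\gamma$ is closed. Near a point outside $\Delta$ define $k$ (nonvanishing) by $dk=-\gamma k$ and abelian first integrals $u_i$ of the foliations by $du_i=k\sigma_i$, $u_1+u_2+u_3=0$; they are unique up to a common constant factor and additive constants. Any symmetry satisfies $X(u_i)=Cu_i+c_i$ with constants $C,c_1,c_2,c_3$. $I_i$ being a first integral means that it is constant along the leaves of the $i$-th foliation, $dy=p_idx$. *)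

theory Defs
  imports "HOL-Complex_Analysis.Complex_Analysis" "HOL-Library.Numeral_Type"
begin

type_synonym point = "complex \<times> complex"

text \<open>Holomorphy in two variables: at each point of the (open) set there is a complex-linear
  Frechet derivative. The set is always assumed open where this is used.\<close>

definition hol2 :: "(point \<Rightarrow> complex) \<Rightarrow> point set \<Rightarrow> bool" where
  "hol2 f S \<longleftrightarrow> (\<forall>z\<in>S. \<exists>a b. (f has_derivative (\<lambda>h. a * fst h + b * snd h)) (at z))"

definition biholomorphic2 :: "point set \<Rightarrow> point set \<Rightarrow> (point \<Rightarrow> point) \<Rightarrow> bool" where
  "biholomorphic2 N M \<Phi> \<longleftrightarrow> open N \<and> open M \<and> bij_betw \<Phi> N M \<and>
     hol2 (\<lambda>z. fst (\<Phi> z)) N \<and> hol2 (\<lambda>z. snd (\<Phi> z)) N \<and>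
     hol2 (\<lambda>w. fst (inv_into N \<Phi> w)) M \<and> hol2 (\<lambda>w. snd (inv_into N \<Phi> w)) M"

definition pdx :: "(point \<Rightarrow> complex) \<Rightarrow> point \<Rightarrow> complex" where
  "pdx f z = deriv (\<lambda>x. f (x, snd z)) (fst z)"

definition pdy :: "(point \<Rightarrow> complex) \<Rightarrow> point \<Rightarrow> complex" where
  "pdy f z = deriv (\<lambda>y. f (fst z, y)) (snd z)"

definition cscale :: "complex \<Rightarrow> complex \<times> complex \<Rightarrow> complex \<times> complex" where
  "cscale c v = (c * fst v, c * snd v)"

definition det2 :: "complex \<times> complex \<Rightarrow> complex \<times> complex \<Rightarrow> complex" where
  "det2 v w = fst v * snd w - snd v * fst w"

text \<open>A 1-form \<open>a dx + b dy\<close> is represented by \<open>\<lambda>z. (a z, b z)\<close>, and a 2-form by its coefficient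
  of \<open>dx \<and> dy\<close>. Thus \<^const>\<open>det2\<close> is the wedge product of 1-forms, \<open>ext_d0\<close> the differential of a
  function and \<open>ext_d1\<close> the exterior derivative of a 1-form.\<close>

definition ext_d0 :: "(point \<Rightarrow> complex) \<Rightarrow> point \<Rightarrow> complex \<times> complex" where
  "ext_d0 f z = (pdx f z, pdy f z)"

definition ext_d1 :: "(point \<Rightarrow> complex \<times> complex) \<Rightarrow> point \<Rightarrow> complex" where
  "ext_d1 \<omega> z = pdx (\<lambda>w. snd (\<omega> w)) z - pdy (\<lambda>w. fst (\<omega> w)) z"

definition vf_apply ::
    "(point \<Rightarrow> complex) \<Rightarrow> (point \<Rightarrow> complex) \<Rightarrow> (point \<Rightarrow> complex) \<Rightarrow> point \<Rightarrow> complex" where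
  "vf_apply \<xi> \<eta> f z = \<xi> z * pdx f z + \<eta> z * pdy f z"

definition discriminant_curve :: "(point \<Rightarrow> complex) \<Rightarrow> (point \<Rightarrow> complex) \<Rightarrow> point set" where
  "discriminant_curve A B = {z. 4 * A z ^ 3 + 27 * B z ^ 2 = 0}"

text \<open>\<open>leaf R L\<close>: \<open>L\<close> is a connected embedded curve, near each of its points the graph of a
  holomorphic function \<open>f\<close> whose slope \<open>f' x\<close> at \<open>(x, f x)\<close> is allowed by \<open>R\<close>. So \<open>L\<close> is a relatively
  open connected piece of a leaf; no maximality is required. Vertical tangents need not be
  considered, because the cubic for the slope is monic.\<close>

definition leaf :: "(point \<Rightarrow> complex \<Rightarrow> bool) \<Rightarrow> point set \<Rightarrow> bool" where
  "leaf R L \<longleftrightarrow> L \<noteq> {} \<and> connected L \<and>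
     (\<forall>z\<in>L. \<exists>N S f. open N \<and> z \<in> N \<and> open S \<and> f holomorphic_on S \<and>
        (\<forall>x\<in>S. R (x, f x) (deriv f x)) \<and> L \<inter> N = (\<lambda>x. (x, f x)) ` S)"

definition web_leaf ::
    "(point \<Rightarrow> complex) \<Rightarrow> (point \<Rightarrow> complex) \<Rightarrow> point set \<Rightarrow> point set \<Rightarrow> bool" where
  "web_leaf A B D =
     leaf (\<lambda>z m. z \<in> D - discriminant_curve A B \<and> m ^ 3 + A z * m + B z = 0)"

definition foliation_leaf :: "(point \<Rightarrow> complex) \<Rightarrow> point set \<Rightarrow> point set \<Rightarrow> bool" where
  "foliation_leaf p W = leaf (\<lambda>z m. z \<in> W \<and> m = p z)"

definition first_integral :: "(point \<Rightarrow> complex) \<Rightarrow> point set \<Rightarrow> (point \<Rightarrow> complex) \<Rightarrow> bool" where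
  "first_integral p W I \<longleftrightarrow> hol2 I W \<and> (\<forall>L. foliation_leaf p W L \<longrightarrow> I constant_on L)"

text \<open>The chart \<open>\<Phi>\<close> puts the pieces of leaves contained in \<open>N\<close> in correspondence with the pieces of
  lines in \<open>\<Phi> ` N\<close> having one of three pairwise non-parallel directions \<open>v i\<close>.\<close>

definition flat_web :: "(point \<Rightarrow> complex) \<Rightarrow> (point \<Rightarrow> complex) \<Rightarrow> point set \<Rightarrow> bool" where
  "flat_web A B D \<longleftrightarrow>
     (\<forall>q \<in> D - discriminant_curve A B. \<exists>N M \<Phi> (v :: 3 \<Rightarrow> complex \<times> complex).
        q \<in> N \<and> N \<subseteq> D - discriminant_curve A B \<and> biholomorphic2 N M \<Phi> \<and>
        (\<forall>i j. i \<noteq> j \<longrightarrow> det2 (v i) (v j) \<noteq> 0) \<and>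
        (\<forall>L\<subseteq>N. web_leaf A B D L \<longleftrightarrow>
           (\<exists>i w T. open T \<and> connected T \<and> T \<noteq> {} \<and> \<Phi> ` L = (\<lambda>t. w + cscale t (v i)) ` T)))"

text \<open>Complex time; joint holomorphy in time and initial point is automatic from uniqueness.\<close>

definition local_flow ::
    "(point \<Rightarrow> complex) \<Rightarrow> (point \<Rightarrow> complex) \<Rightarrow> point set \<Rightarrow> point set \<Rightarrow> real
     \<Rightarrow> (complex \<Rightarrow> point \<Rightarrow> point) \<Rightarrow> bool" where
  "local_flow \<xi> \<eta> D N e \<phi> \<longleftrightarrow>
     (\<forall>z\<in>N. \<phi> 0 z = z \<and>
       (\<forall>t \<in> ball 0 e. \<phi> t z \<in> D \<and>
          ((\<lambda>s. fst (\<phi> s z)) has_field_derivative \<xi> (\<phi> t z)) (at t) \<and>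
          ((\<lambda>s. snd (\<phi> s z)) has_field_derivative \<eta> (\<phi> t z)) (at t)))"

definition web_symmetry ::
    "(point \<Rightarrow> complex) \<Rightarrow> (point \<Rightarrow> complex) \<Rightarrow> point set
     \<Rightarrow> (point \<Rightarrow> complex) \<Rightarrow> (point \<Rightarrow> complex) \<Rightarrow> bool" where
  "web_symmetry A B D \<xi> \<eta> \<longleftrightarrow>
     hol2 \<xi> D \<and> hol2 \<eta> D \<and> (\<exists>z\<in>D. \<xi> z \<noteq> 0 \<or> \<eta> z \<noteq> 0) \<and>
     (\<forall>q \<in> D - discriminant_curve A B. \<exists>N e \<phi>.
        open N \<and> q \<in> N \<and> N \<subseteq> D \<and> e > 0 \<and> local_flow \<xi> \<eta> D N e \<phi> \<and>
        (\<forall>t \<in> ball 0 e. \<forall>L\<subseteq>N. web_leaf A B D L \<longrightarrow> web_leaf A B D (\<phi> t ` L)))"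

text \<open>The foliations are indexed by the type \<open>3\<close>, whose arithmetic is modulo 3 (so index \<open>3\<close> is
  \<open>0\<close>), which makes the definition of \<open>sigma\<close> cyclic.\<close>

definition web_roots ::
    "(point \<Rightarrow> complex) \<Rightarrow> (point \<Rightarrow> complex) \<Rightarrow> point set \<Rightarrow> (3 \<Rightarrow> point \<Rightarrow> complex) \<Rightarrow> bool" where
  "web_roots A B V p \<longleftrightarrow> (\<forall>i. hol2 (p i) V) \<and>
     (\<forall>z\<in>V. inj (\<lambda>i. p i z) \<and> (\<forall>i. p i z ^ 3 + A z * p i z + B z = 0))"

definition sigma :: "(3 \<Rightarrow> point \<Rightarrow> complex) \<Rightarrow> 3 \<Rightarrow> point \<Rightarrow> complex \<times> complex" where
  "sigma p i z = cscale (p (i + 1) z - p (i + 2) z) (- p i z, 1)"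

definition Omega :: "(3 \<Rightarrow> point \<Rightarrow> complex) \<Rightarrow> point \<Rightarrow> complex" where
  "Omega p z = det2 (sigma p 1 z) (sigma p 2 z)"

definition chern_coeff :: "(3 \<Rightarrow> point \<Rightarrow> complex) \<Rightarrow> 3 \<Rightarrow> point \<Rightarrow> complex" where
  "chern_coeff p i z = ext_d1 (sigma p i) z / Omega p z"

definition chern_form :: "(3 \<Rightarrow> point \<Rightarrow> complex) \<Rightarrow> point \<Rightarrow> complex \<times> complex" where
  "chern_form p z =
     cscale (chern_coeff p 2 z) (sigma p 1 z) - cscale (chern_coeff p 1 z) (sigma p 2 z)"

definition chern_factor ::
    "(3 \<Rightarrow> point \<Rightarrow> complex) \<Rightarrow> point set \<Rightarrow> (point \<Rightarrow> complex) \<Rightarrow> bool" where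
  "chern_factor p V k \<longleftrightarrow> hol2 k V \<and>
     (\<forall>z\<in>V. k z \<noteq> 0 \<and> ext_d0 k z = cscale (- k z) (chern_form p z))"

definition abelian_integrals ::
    "(3 \<Rightarrow> point \<Rightarrow> complex) \<Rightarrow> point set \<Rightarrow> (point \<Rightarrow> complex) \<Rightarrow> (3 \<Rightarrow> point \<Rightarrow> complex) \<Rightarrow> bool" where
  "abelian_integrals p V k u \<longleftrightarrow> (\<forall>i. hol2 (u i) V) \<and>
     (\<forall>z\<in>V. (\<forall>i. ext_d0 (u i) z = cscale (k z) (sigma p i z)) \<and> u 1 z + u 2 z + u 3 z = 0)"

end

theory Submission imports Defs "HOL-Computational_Algebra.Fundamental_Theorem_Algebra"
begin

text \<open>Put \<open>w\<^sub>i = (p\<^sub>i\<^sub>+\<^sub>1 - p\<^sub>i\<^sub>+\<^sub>2)(\<eta> - p\<^sub>i \<xi>)\<close>, the value of \<open>\<sigma>\<^sub>i\<close> on the symmetry \<open>X\<close>. Where abelian integrals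
\<open>u\<^sub>i\<close> are available, \<open>du\<^sub>i = k \<sigma>\<^sub>i\<close> gives \<open>X(u\<^sub>i) = k w\<^sub>i\<close>, so \<open>k w\<^sub>i = C u\<^sub>i + c\<^sub>i\<close> is constant along the
leaves of the \<open>i\<close>-th foliation, and so is \<open>I\<^sub>i = (k w\<^sub>i)\<^sup>2 = k\<^sup>2 U\<^sub>i\<close> with \<open>U\<^sub>i = w\<^sub>i\<^sup>2\<close>. Since
\<open>w\<^sub>1 + w\<^sub>2 + w\<^sub>3 = 0\<close>, the \<open>w\<^sub>i\<close> are the roots of a depressed cubic \<open>w\<^sup>3 - \<alpha> w - r\<close> with
\<open>r = w\<^sub>1 w\<^sub>2 w\<^sub>3\<close>, and their squares are the roots of \<open>U (U - \<alpha>)\<^sup>2 = r\<^sup>2\<close>; expressing \<open>\<alpha>\<close> and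
\<open>\<beta> = -r\<^sup>2\<close> by the coefficients of the ODE gives the formulas of the theorem
(\<open>cubic_of_squares\<close>).

The identity \<open>X(u\<^sub>i) = C u\<^sub>i + c\<^sub>i\<close> is known only over \<open>V\<^sub>0\<close>, whereas \<open>k\<close> and the \<open>I\<^sub>i\<close> are needed near every
point of \<open>D\<close> outside the discriminant curve. Analytic continuation of the multivalued functions
\<open>p\<^sub>i\<close>, \<open>k\<close>, \<open>u\<^sub>i\<close> is avoided by passing to consequences that do not mention the roots: the vanishing
of certain polynomials in \<open>A\<close>, \<open>B\<close>, \<open>\<xi>\<close>, \<open>\<eta>\<close> and their derivatives. These polynomials are holomorphic
on all of \<open>D\<close>, across the discriminant curve as well, so the identity theorem on the connected set \<open>D\<close>
(\<open>hol2_identity\<close>) carries their vanishing from \<open>V\<^sub>0\<close> to \<open>D\<close>. Two such facts suffice.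

First, the Chern form is \<open>(g\<^sub>1 dx + g\<^sub>2 dy) / (4A\<^sup>3 + 27B\<^sup>2)\<close> with \<open>g\<^sub>1\<close>, \<open>g\<^sub>2\<close> holomorphic on \<open>D\<close>
(\<open>chern_form_eq\<close>). The factor \<open>k\<close> over \<open>V\<^sub>0\<close> shows that it is closed there. After
multiplication by the squared discriminant, closedness is the vanishing of a function holomorphic on \<open>D\<close>,
so the form is closed everywhere outside the discriminant curve, and the Poincare lemma provides \<open>k\<close> near each point (\<open>chern_factor_exists\<close>).

Secondly, the derivative of \<open>k w\<^sub>i\<close> along the \<open>i\<close>-th foliation is \<open>k (p\<^sub>i\<^sub>+\<^sub>1 - p\<^sub>i\<^sub>+\<^sub>2)\<close> times the defect
of \<open>X\<close> as an infinitesimal symmetry of \<open>dy = p\<^sub>i dx\<close> (\<open>leaf_integral_derivative\<close>). Up to the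
nonzero factor \<open>3p\<^sub>i\<^sup>2 + A\<close> this defect is a quadratic polynomial in \<open>p\<^sub>i\<close> with coefficients that
are holomorphic on \<open>D\<close> (\<open>symmetry_defect_eq\<close>). Over \<open>V\<^sub>0\<close> the quadratic has three distinct roots,
so its coefficients vanish there, hence on \<open>D\<close>; consequently each \<open>k w\<^sub>i\<close> is a first integral near every
point outside the discriminant curve.

The remaining ingredients are the elementary theory of holomorphic functions of two variables,
derived from Cauchy's formula in one variable, and the holomorphic dependence of simple roots on
the coefficients.\<close>

section \<open>Partial derivatives of holomorphic functions of two variables\<close>

text \<open>Naming the coefficients of the differential makes a calculus of explicit rules possible: a partial
derivative is computed by building the predicate with the rules and reading off the coefficient.\<close>

definition has_partials :: "(point \<Rightarrow> complex) \<Rightarrow> complex \<Rightarrow> complex \<Rightarrow> point \<Rightarrow> bool" where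
  "has_partials f a b z \<longleftrightarrow> (f has_derivative (\<lambda>h. a * fst h + b * snd h)) (at z)"

lemma has_partials_along_curve:
  assumes f: "has_partials f a b (g t, h t)"
    and g: "(g has_field_derivative g') (at t)" and h: "(h has_field_derivative h') (at t)"
  shows "((\<lambda>t. f (g t, h t)) has_field_derivative a * g' + b * h') (at t)"
proof -
  have "((\<lambda>t. (g t, h t)) has_derivative (\<lambda>s. (g' * s, h' * s))) (at t)"
    using g h unfolding has_field_derivative_def by (rule has_derivative_Pair)
  then have "((\<lambda>t. f (g t, h t)) has_derivative
      (\<lambda>s. a * fst (g' * s, h' * s) + b * snd (g' * s, h' * s))) (at t)"
    by (rule has_derivative_compose) (use f in \<open>simp add: has_partials_def\<close>)
  then show ?thesis
    unfolding has_field_derivative_def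
    by (rule has_derivative_eq_rhs) (auto simp: algebra_simps)
qed

lemma has_partials_pdx: "has_partials f a b z \<Longrightarrow> pdx f z = a"
  using has_partials_along_curve[of f a b "\<lambda>x. x" "fst z" "\<lambda>x. snd z" 1 0]
  unfolding pdx_def by (auto intro!: DERIV_imp_deriv)

lemma has_partials_pdy: "has_partials f a b z \<Longrightarrow> pdy f z = b"
  using has_partials_along_curve[of f a b "\<lambda>x. fst z" "snd z" "\<lambda>x. x" 0 1]
  unfolding pdy_def by (auto intro!: DERIV_imp_deriv)

lemma hol2D:
  assumes "hol2 f S" "z \<in> S"
  shows "has_partials f (pdx f z) (pdy f z) z"
proof -
  obtain a b where "has_partials f a b z"
    using assms unfolding hol2_def has_partials_def by blast
  then show ?thesis
    using has_partials_pdx has_partials_pdy by simp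
qed

lemma hol2I: "(\<And>z. z \<in> S \<Longrightarrow> has_partials f (a z) (b z) z) \<Longrightarrow> hol2 f S"
  unfolding hol2_def has_partials_def by blast

lemma hol2_subset: "hol2 f S \<Longrightarrow> T \<subseteq> S \<Longrightarrow> hol2 f T"
  unfolding hol2_def by blast

lemma hol2_continuous_on: "hol2 f S \<Longrightarrow> continuous_on S f"
  unfolding hol2_def by (intro continuous_at_imp_continuous_on ballI) (blast dest: has_derivative_continuous)

lemma has_partials_cong:
  assumes "has_partials f a b z" "open S" "z \<in> S" "\<And>w. w \<in> S \<Longrightarrow> f w = g w"
  shows "has_partials g a b z"
  using assms(1) unfolding has_partials_def
  by (rule has_derivative_transform_within_open[of _ _ _ _ S]) (use assms in auto)

lemma pdx_cong:
  assumes "open S" "z \<in> S" "\<And>w. w \<in> S \<Longrightarrow> f w = g w"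
  shows "pdx f z = pdx g z"
  unfolding pdx_def
proof (rule deriv_cong_ev)
  have "open ((\<lambda>x. (x, snd z)) -` S)"
    using \<open>open S\<close> by (intro continuous_open_vimage continuous_intros)
  then have "\<forall>\<^sub>F x in nhds (fst z). (x, snd z) \<in> S"
    unfolding eventually_nhds using assms(2) by (intro exI[of _ "(\<lambda>x. (x, snd z)) -` S"]) auto
  then show "\<forall>\<^sub>F x in nhds (fst z). f (x, snd z) = g (x, snd z)"
    by eventually_elim (use assms in auto)
qed simp

lemma pdy_swap: "pdy f z = pdx (f \<circ> prod.swap) (prod.swap z)"
  by (simp add: pdx_def pdy_def prod.swap_def)

lemma pdy_cong:
  assumes "open S" "z \<in> S" "\<And>w. w \<in> S \<Longrightarrow> f w = g w"
  shows "pdy f z = pdy g z"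
proof -
  have "open (prod.swap -` S)"
    using \<open>open S\<close> by (intro continuous_open_vimage) (auto intro!: continuous_intros simp: prod.swap_def)
  then show ?thesis
    unfolding pdy_swap using assms
    by (intro pdx_cong[of "prod.swap -` S"]) auto
qed

lemma has_partials_const: "has_partials (\<lambda>_. c) 0 0 z"
  by (simp add: has_partials_def)

lemma has_partials_add:
  "has_partials f a b z \<Longrightarrow> has_partials g a' b' z \<Longrightarrow> has_partials (\<lambda>w. f w + g w) (a + a') (b + b') z"
  unfolding has_partials_def by (drule (1) has_derivative_add) (simp add: algebra_simps)

lemma has_partials_diff:
  "has_partials f a b z \<Longrightarrow> has_partials g a' b' z \<Longrightarrow> has_partials (\<lambda>w. f w - g w) (a - a') (b - b') z"
  unfolding has_partials_def by (drule (1) has_derivative_diff) (simp add: algebra_simps)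

lemma has_partials_minus:
  "has_partials f a b z \<Longrightarrow> has_partials (\<lambda>w. - f w) (- a) (- b) z"
  using has_partials_diff[OF has_partials_const[of 0]] by simp

lemma has_partials_mult:
  "has_partials f a b z \<Longrightarrow> has_partials g a' b' z \<Longrightarrow>
   has_partials (\<lambda>w. f w * g w) (a * g z + f z * a') (b * g z + f z * b') z"
  unfolding has_partials_def
  by (rule has_derivative_eq_rhs, rule has_derivative_mult) (auto simp: algebra_simps)

lemma has_partials_compose:
  assumes "(g has_field_derivative d) (at (f z))" "has_partials f a b z"
  shows "has_partials (\<lambda>w. g (f w)) (d * a) (d * b) z"
  using has_derivative_compose[OF assms(2)[unfolded has_partials_def] assms(1)[unfolded has_field_derivative_def]]
  by (simp add: has_partials_def algebra_simps)

lemma has_partials_power: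
  "has_partials f a b z \<Longrightarrow>
   has_partials (\<lambda>w. f w ^ n) (of_nat n * f z ^ (n - 1) * a) (of_nat n * f z ^ (n - 1) * b) z"
  by (rule has_partials_compose[where g = "\<lambda>x. x ^ n"]) (auto intro!: derivative_eq_intros)

lemma has_partials_divide:
  assumes "has_partials f a b z" "has_partials g a' b' z" "g z \<noteq> 0"
  shows "has_partials (\<lambda>w. f w / g w)
    ((a * g z - f z * a') / g z ^ 2) ((b * g z - f z * b') / g z ^ 2) z"
proof -
  have "has_partials (\<lambda>w. inverse (g w)) (- inverse (g z ^ 2) * a') (- inverse (g z ^ 2) * b') z"
    using assms(2,3) by (intro has_partials_compose[where g = inverse])
      (auto intro!: derivative_eq_intros simp: power2_eq_square)
  from has_partials_mult[OF assms(1) this] show ?thesis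
    using assms(3) by (simp add: field_simps power2_eq_square)
qed

lemma has_partials_exp:
  "has_partials f a b z \<Longrightarrow> has_partials (\<lambda>w. exp (f w)) (exp (f z) * a) (exp (f z) * b) z"
  by (rule has_partials_compose) (rule DERIV_exp)

lemmas has_partials_intros = has_partials_const has_partials_add has_partials_diff
  has_partials_minus has_partials_mult has_partials_power has_partials_divide has_partials_exp

lemma hol2_const: "hol2 (\<lambda>_. c) S"
  by (rule hol2I) (rule has_partials_const)

lemma hol2_add: "hol2 f S \<Longrightarrow> hol2 g S \<Longrightarrow> hol2 (\<lambda>z. f z + g z) S"
  by (rule hol2I) (rule has_partials_add; erule (1) hol2D)

lemma hol2_diff: "hol2 f S \<Longrightarrow> hol2 g S \<Longrightarrow> hol2 (\<lambda>z. f z - g z) S"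
  by (rule hol2I) (rule has_partials_diff; erule (1) hol2D)

lemma hol2_mult: "hol2 f S \<Longrightarrow> hol2 g S \<Longrightarrow> hol2 (\<lambda>z. f z * g z) S"
  by (rule hol2I) (rule has_partials_mult; erule (1) hol2D)

lemma hol2_power: "hol2 f S \<Longrightarrow> hol2 (\<lambda>z. f z ^ n) S"
  by (rule hol2I) (rule has_partials_power; erule (1) hol2D)

lemma hol2_divide: "hol2 f S \<Longrightarrow> hol2 g S \<Longrightarrow> (\<And>z. z \<in> S \<Longrightarrow> g z \<noteq> 0) \<Longrightarrow> hol2 (\<lambda>z. f z / g z) S"
  by (rule hol2I) (rule has_partials_divide; (erule (1) hol2D | simp))

lemmas hol2_intros = hol2_const hol2_add hol2_diff hol2_mult hol2_power

lemma hol2_swap: "hol2 f S \<Longrightarrow> hol2 (f \<circ> prod.swap) (prod.swap -` S)"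
proof (rule hol2I)
  fix z assume f: "hol2 f S" and z: "z \<in> prod.swap -` S"
  have "((\<lambda>w. prod.swap w) has_derivative (\<lambda>h. prod.swap h)) (at z)"
    unfolding prod.swap_def by (auto intro!: derivative_eq_intros)
  then have "((\<lambda>w. f (prod.swap w)) has_derivative
      (\<lambda>h. pdx f (prod.swap z) * fst (prod.swap h) + pdy f (prod.swap z) * snd (prod.swap h))) (at z)"
    by (rule has_derivative_compose) (use hol2D[OF f, of "prod.swap z"] z in \<open>simp add: has_partials_def\<close>)
  then show "has_partials (f \<circ> prod.swap) (pdy f (prod.swap z)) (pdx f (prod.swap z)) z"
    by (simp add: has_partials_def o_def add.commute)
qed

lemma open_swap: "open S \<Longrightarrow> open (prod.swap -` (S::point set))"
  by (intro continuous_open_vimage) (auto intro!: continuous_intros simp: prod.swap_def)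

section \<open>Derivatives of holomorphic functions are holomorphic\<close>

text \<open>The right-hand side of Cauchy's formula for \<open>\<partial>f/\<partial>x\<close> at \<open>(x, y)\<close>, with \<open>y\<close> as a parameter. All regularity of
partial derivatives is obtained by differentiating this integral in the parameter.\<close>

definition cauchy_x :: "(point \<Rightarrow> complex) \<Rightarrow> complex \<Rightarrow> real \<Rightarrow> complex \<Rightarrow> complex \<Rightarrow> complex" where
  "cauchy_x f x\<^sub>0 r x y =
     1 / (2 * of_real pi * \<i>) * contour_integral (circlepath x\<^sub>0 r) (\<lambda>u. f (u, y) / (u - x) ^ 2)"

lemma hol2_slice_x: "hol2 f S \<Longrightarrow> (x, y) \<in> S \<Longrightarrow>
    ((\<lambda>x. f (x, y)) has_field_derivative pdx f (x, y)) (at x)"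
  using has_partials_along_curve[of f "pdx f (x, y)" "pdy f (x, y)" "\<lambda>x. x" x "\<lambda>x. y" 1 0] hol2D
  by force

lemma hol2_slice_y: "hol2 f S \<Longrightarrow> (x, y) \<in> S \<Longrightarrow>
    ((\<lambda>y. f (x, y)) has_field_derivative pdy f (x, y)) (at y)"
  using has_partials_along_curve[of f "pdx f (x, y)" "pdy f (x, y)" "\<lambda>y. x" y "\<lambda>y. y" 0 1] hol2D
  by force

lemma pdx_eq_cauchy_x:
  assumes f: "hol2 f S" and sub: "cball x\<^sub>0 r \<times> ball y\<^sub>0 r \<subseteq> S"
    and x: "x \<in> ball x\<^sub>0 r" and y: "y \<in> ball y\<^sub>0 r"
  shows "pdx f (x, y) = cauchy_x f x\<^sub>0 r x y"
proof -
  have d: "((\<lambda>x. f (x, y)) has_field_derivative pdx f (u, y)) (at u)" if "u \<in> cball x\<^sub>0 r" for u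
    using that y sub by (intro hol2_slice_x[OF f]) auto
  have "continuous_on (cball x\<^sub>0 r) (\<lambda>x. f (x, y))"
    by (intro continuous_at_imp_continuous_on ballI DERIV_isCont[OF d])
  moreover have "(\<lambda>x. f (x, y)) holomorphic_on ball x\<^sub>0 r"
    by (auto simp: holomorphic_on_open intro!: exI d)
  ultimately have "((\<lambda>x. f (x, y)) has_field_derivative cauchy_x f x\<^sub>0 r x y) (at x)"
    unfolding cauchy_x_def by (rule Cauchy_derivative_integral_circlepath(2)[OF _ _ x])
  with d[of x] x show ?thesis by (auto intro: DERIV_unique)
qed

lemma cauchy_x_integral:
  "cauchy_x f x\<^sub>0 r x y = integral (cbox 0 1) (\<lambda>t. f (circlepath x\<^sub>0 r t, y) / (circlepath x\<^sub>0 r t - x) ^ 2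
     * (r * exp (2 * of_real pi * \<i> * of_real t)))"
proof -
  have "cauchy_x f x\<^sub>0 r x y = integral {0..1} (\<lambda>t. 1 / (2 * of_real pi * \<i>) *
      (f (circlepath x\<^sub>0 r t, y) / (circlepath x\<^sub>0 r t - x) ^ 2 * vector_derivative (circlepath x\<^sub>0 r) (at t)))"
    unfolding cauchy_x_def contour_integral_integral by (simp only: integral_mult_right)
  also have "\<dots> = integral (cbox 0 1) (\<lambda>t. f (circlepath x\<^sub>0 r t, y) / (circlepath x\<^sub>0 r t - x) ^ 2
      * (r * exp (2 * of_real pi * \<i> * of_real t)))"
  proof -
    have "1 / c * (a * (c * b * e)) = a * (b * e)" if "c \<noteq> 0" for a b c e :: complex
      using that by simp
    from this[of "2 * of_real pi * \<i>"] show ?thesis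
      by (simp only: vector_derivative_circlepath box_real) simp
  qed
  finally show ?thesis .
qed

text \<open>Joint continuity in the point and in the integration variable is what both theorems on
integrals with parameters, on continuity and on differentiation, ask for. The denominator does not
vanish because \<open>x\<close> stays in the open disc and \<open>u\<close> on its boundary.\<close>

lemma cauchy_x_integrand_continuous:
  assumes f: "continuous_on (sphere x\<^sub>0 r \<times> T) f" and r: "r > 0"
  shows "continuous_on ((ball x\<^sub>0 r \<times> T) \<times> cbox 0 1)
    (\<lambda>(z, t). f (circlepath x\<^sub>0 r t, snd z) / (circlepath x\<^sub>0 r t - fst z) ^ 2
     * (r * exp (2 * of_real pi * \<i> * of_real t)))"
proof -
  have c: "continuous_on UNIV (\<lambda>t. circlepath x\<^sub>0 r t)"
    unfolding circlepath by (intro continuous_intros)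
  have s: "circlepath x\<^sub>0 r t \<in> sphere x\<^sub>0 r" for t
    using r by (simp add: circlepath dist_norm norm_mult)
  have "continuous_on ((ball x\<^sub>0 r \<times> T) \<times> cbox 0 1) (\<lambda>p. f (circlepath x\<^sub>0 r (snd p), snd (fst p)))"
    using s by (intro continuous_on_compose2[OF f] continuous_intros continuous_on_compose2[OF c]) auto
  moreover have "circlepath x\<^sub>0 r t \<noteq> x" if "x \<in> ball x\<^sub>0 r" for x t
    using s[of t] that by auto
  ultimately show ?thesis
    unfolding split_beta
    by (intro continuous_intros continuous_on_compose2[OF c]) auto
qed

lemma cauchy_x_continuous:
  assumes f: "continuous_on (sphere x\<^sub>0 r \<times> T) f" and r: "r > 0"
  shows "continuous_on (ball x\<^sub>0 r \<times> T) (\<lambda>z. cauchy_x f x\<^sub>0 r (fst z) (snd z))"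
  unfolding cauchy_x_integral
  by (rule integral_continuous_on_param) (rule cauchy_x_integrand_continuous[OF assms])

lemma cauchy_x_deriv_y:
  assumes f: "continuous_on (sphere x\<^sub>0 r \<times> ball y\<^sub>0 r) f"
    and g: "continuous_on (sphere x\<^sub>0 r \<times> ball y\<^sub>0 r) g" and r: "r > 0"
    and d: "\<And>u y. u \<in> sphere x\<^sub>0 r \<Longrightarrow> y \<in> ball y\<^sub>0 r \<Longrightarrow> ((\<lambda>y. f (u, y)) has_field_derivative g (u, y)) (at y)"
    and x: "x \<in> ball x\<^sub>0 r" and y: "y \<in> ball y\<^sub>0 r"
  shows "((\<lambda>y. cauchy_x f x\<^sub>0 r x y) has_field_derivative cauchy_x g x\<^sub>0 r x y) (at y)"
proof -
  have s: "circlepath x\<^sub>0 r t \<in> sphere x\<^sub>0 r" for t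
    using r by (simp add: circlepath dist_norm norm_mult)
  have slice: "continuous_on (ball y\<^sub>0 r \<times> cbox 0 1)
    (\<lambda>(y, t). h (circlepath x\<^sub>0 r t, y) / (circlepath x\<^sub>0 r t - x) ^ 2
     * (r * exp (2 * of_real pi * \<i> * of_real t)))"
    if "continuous_on (sphere x\<^sub>0 r \<times> ball y\<^sub>0 r) h" for h
  proof -
    have "continuous_on (ball y\<^sub>0 r \<times> cbox 0 1) (\<lambda>p::complex \<times> real. ((x, fst p), snd p))"
      by (intro continuous_intros)
    moreover have "(\<lambda>p. ((x, fst p), snd p)) ` (ball y\<^sub>0 r \<times> cbox (0::real) 1)
        \<subseteq> (ball x\<^sub>0 r \<times> ball y\<^sub>0 r) \<times> cbox 0 1"
      using x by auto
    ultimately show ?thesis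
      using continuous_on_compose2[OF cauchy_x_integrand_continuous[OF that r],
        where f = "\<lambda>p. ((x, fst p), snd p)" and s = "ball y\<^sub>0 r \<times> cbox 0 1"]
      by (simp add: split_beta del: times_divide_eq_left times_divide_eq_right)
  qed
  have "((\<lambda>y. cauchy_x f x\<^sub>0 r x y) has_field_derivative cauchy_x g x\<^sub>0 r x y) (at y within ball y\<^sub>0 r)"
    unfolding cauchy_x_integral
  proof (rule leibniz_rule_field_derivative[OF _ _ slice[OF g] y convex_ball])
    fix y t assume "y \<in> ball y\<^sub>0 r"
    then show "((\<lambda>y. f (circlepath x\<^sub>0 r t, y) / (circlepath x\<^sub>0 r t - x) ^ 2
         * (r * exp (2 * of_real pi * \<i> * of_real t))) has_field_derivative
       g (circlepath x\<^sub>0 r t, y) / (circlepath x\<^sub>0 r t - x) ^ 2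
         * (r * exp (2 * of_real pi * \<i> * of_real t))) (at y within ball y\<^sub>0 r)"
      by (intro DERIV_cmult_right DERIV_cdivide has_field_derivative_at_within[OF d[OF s]])
    show "(\<lambda>t. f (circlepath x\<^sub>0 r t, y) / (circlepath x\<^sub>0 r t - x) ^ 2
         * (r * exp (2 * of_real pi * \<i> * of_real t))) integrable_on cbox 0 1"
    proof (rule integrable_continuous)
      have "continuous_on (cbox 0 1) (\<lambda>t::real. (y, t))" by (intro continuous_intros)
      moreover have "(\<lambda>t. (y, t)) ` cbox (0::real) 1 \<subseteq> ball y\<^sub>0 r \<times> cbox 0 1"
        using \<open>y \<in> ball y\<^sub>0 r\<close> by auto
      ultimately show "continuous_on (cbox 0 1) (\<lambda>t. f (circlepath x\<^sub>0 r t, y) / (circlepath x\<^sub>0 r t - x) ^ 2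
          * (r * exp (2 * of_real pi * \<i> * of_real t)))"
        using continuous_on_compose2[OF slice[OF f], where f = "\<lambda>t. (y, t)" and s = "cbox 0 1"]
        by (simp add: split_beta del: times_divide_eq_left times_divide_eq_right)
    qed
  qed
  then show ?thesis by (simp only: at_within_open[OF y open_ball])
qed

lemma open_contains_bidisc:
  assumes "open S" "z \<in> S"
  obtains r where "r > 0" "cball (fst z) r \<times> cball (snd z) r \<subseteq> (S :: point set)"
proof -
  obtain P Q where PQ: "open P" "open Q" "z \<in> P \<times> Q" "P \<times> Q \<subseteq> S"
    using open_prod_elim[OF assms] .
  obtain r where r: "r > 0" "cball (fst z) r \<subseteq> P"
    using PQ(1,3) open_contains_cball[of P] by (auto simp: mem_Times_iff)
  obtain s where s: "s > 0" "cball (snd z) s \<subseteq> Q"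
    using PQ(2,3) open_contains_cball[of Q] by (auto simp: mem_Times_iff)
  have "cball (fst z) (min r s) \<subseteq> P" "cball (snd z) (min r s) \<subseteq> Q"
    using r s by (auto intro: order_trans[OF subset_cball])
  then have "cball (fst z) (min r s) \<times> cball (snd z) (min r s) \<subseteq> S"
    using PQ(4) by blast
  then show ?thesis using r s by (intro that[of "min r s"]) auto
qed

lemma continuous_on_pdx:
  assumes f: "hol2 f S" and S: "open S"
  shows "continuous_on S (pdx f)"
proof (rule continuous_at_imp_continuous_on, rule ballI)
  fix z assume "z \<in> S"
  then obtain r where r: "r > 0" "cball (fst z) r \<times> cball (snd z) r \<subseteq> S"
    using open_contains_bidisc[OF S] by blast
  let ?U = "ball (fst z) r \<times> ball (snd z) r"
  have "sphere (fst z) r \<times> ball (snd z) r \<subseteq> S" and sub: "cball (fst z) r \<times> ball (snd z) r \<subseteq> S"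
    using r(2) by auto
  then have "continuous_on ?U (\<lambda>w. cauchy_x f (fst z) r (fst w) (snd w))"
    by (intro cauchy_x_continuous r(1) continuous_on_subset[OF hol2_continuous_on[OF f]])
  then have "continuous_on ?U (pdx f)"
    by (rule continuous_on_eq) (use pdx_eq_cauchy_x[OF f sub] in \<open>auto simp: \<close>)
  then show "isCont (pdx f) z"
    using r(1) by (cases z) (auto simp: continuous_on_eq_continuous_at open_Times)
qed

lemma continuous_on_pdy:
  assumes f: "hol2 f S" and S: "open S"
  shows "continuous_on S (pdy f)"
proof -
  have "continuous_on S (\<lambda>z. pdx (f \<circ> prod.swap) (prod.swap z))"
    using continuous_on_pdx[OF hol2_swap[OF f] open_swap[OF S]]
    by (rule continuous_on_compose2) (auto simp: prod.swap_def intro!: continuous_intros)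
  then show ?thesis by (simp add: pdy_swap)
qed

text \<open>The continuity of one partial derivative is enough for total differentiability. This asymmetry
is used below: for \<open>\<partial>f/\<partial>x\<close> only the derivative in the parameter \<open>y\<close> is controlled as a function of two variables.\<close>

lemma has_partialsI:
  assumes U: "open U" "z \<in> U"
    and x: "((\<lambda>x. f (x, snd z)) has_field_derivative a) (at (fst z))"
    and y: "\<And>w. w \<in> U \<Longrightarrow> ((\<lambda>y. f (fst w, y)) has_field_derivative b w) (at (snd w))"
    and b: "continuous_on U b"
  shows "has_partials f a (b z) z"
proof -
  obtain r where r: "r > 0" "cball (fst z) r \<times> cball (snd z) r \<subseteq> U"
    using open_contains_bidisc[OF U] by blast
  let ?P = "ball (fst z) r" and ?Q = "ball (snd z) r"
  have sub: "?P \<times> ?Q \<subseteq> U" using r(2) by auto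
  have zin: "z \<in> ?P \<times> ?Q" using r(1) by (simp add: mem_Times_iff)
  have "((\<lambda>(x, y). f (x, y)) has_derivative
      (\<lambda>(tx, ty). a * tx + blinfun_apply (blinfun_mult_right (b (fst z, snd z))) ty))
      (at (fst z, snd z) within ?P \<times> ?Q)"
  proof (rule has_derivative_partialsI)
    show "((\<lambda>x. f (x, snd z)) has_derivative (*) a) (at (fst z) within ?P)"
      using x unfolding has_field_derivative_def by (rule has_derivative_at_withinI)
    show "((\<lambda>y. f (x, y)) has_derivative blinfun_apply (blinfun_mult_right (b (x, y)))) (at y within ?Q)"
      if "x \<in> ?P" "y \<in> ?Q" for x y
    proof -
      have "(x, y) \<in> U" using that sub by blast
      from y[OF this] show ?thesis
        unfolding has_field_derivative_def by (auto intro: has_derivative_at_withinI)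
    qed
    have "continuous_on (?P \<times> ?Q) (\<lambda>w. blinfun_mult_right (b w))"
      by (intro bounded_linear.continuous_on[OF bounded_linear_blinfun_mult_right]
            continuous_on_subset[OF b] sub)
    then have "continuous (at z within ?P \<times> ?Q) (\<lambda>w. blinfun_mult_right (b w))"
      using zin unfolding continuous_on_eq_continuous_within by blast
    then show "continuous (at (fst z, snd z) within ?P \<times> ?Q) (\<lambda>(x, y). blinfun_mult_right (b (x, y)))"
      by (simp add: case_prod_unfold)
  qed (use r(1) in \<open>auto simp: mem_Times_iff\<close>)
  then show ?thesis
    unfolding has_partials_def
    by (simp add: at_within_open[OF zin open_Times[OF open_ball open_ball]] case_prod_unfold)
qed

text \<open>Differentiation of Cauchy's formula under the integral sign. The same integral represents
\<open>\<partial>/\<partial>x (\<partial>f/\<partial>y)\<close>, which is why the mixed derivatives agree.\<close>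

lemma pdx_deriv_y:
  assumes f: "hol2 f S" and S: "open S" and sub: "cball x\<^sub>0 r \<times> ball y\<^sub>0 r \<subseteq> S" and r: "r > 0"
    and x: "x \<in> ball x\<^sub>0 r" and y: "y \<in> ball y\<^sub>0 r"
  shows "((\<lambda>y. pdx f (x, y)) has_field_derivative cauchy_x (pdy f) x\<^sub>0 r x y) (at y)"
proof -
  have sub': "sphere x\<^sub>0 r \<times> ball y\<^sub>0 r \<subseteq> S" using sub by auto
  have "((\<lambda>y. cauchy_x f x\<^sub>0 r x y) has_field_derivative cauchy_x (pdy f) x\<^sub>0 r x y) (at y)"
    using sub' by (intro cauchy_x_deriv_y[OF _ _ r _ x y] hol2_slice_y[OF f]
      continuous_on_subset[OF hol2_continuous_on[OF f] sub']
      continuous_on_subset[OF continuous_on_pdy[OF f S] sub']) auto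
  then show ?thesis
    by (rule has_field_derivative_transform_within_open[of _ _ _ "ball y\<^sub>0 r"])
      (use y pdx_eq_cauchy_x[OF f sub x] in auto)
qed

lemma hol2_pdx:
  assumes f: "hol2 f S" and S: "open S"
  shows "hol2 (pdx f) S"
  unfolding hol2_def has_partials_def[symmetric]
proof
  fix z assume "z \<in> S"
  then obtain r where r: "r > 0" "cball (fst z) r \<times> cball (snd z) r \<subseteq> S"
    using open_contains_bidisc[OF S] by blast
  then have sub: "cball (fst z) r \<times> ball (snd z) r \<subseteq> S" by auto
  let ?U = "ball (fst z) r \<times> ball (snd z) r"
  have "(\<lambda>x. f (x, snd z)) holomorphic_on ball (fst z) r"
  proof -
    have "((\<lambda>x. f (x, snd z)) has_field_derivative pdx f (u, snd z)) (at u)" if "u \<in> ball (fst z) r" for u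
      using that r by (intro hol2_slice_x[OF f]) auto
    then show ?thesis unfolding holomorphic_on_open[OF open_ball] by blast
  qed
  then have "deriv (\<lambda>x. f (x, snd z)) holomorphic_on ball (fst z) r"
    by (rule holomorphic_deriv) simp
  then obtain a where a: "((\<lambda>x. pdx f (x, snd z)) has_field_derivative a) (at (fst z))"
    unfolding holomorphic_on_open[OF open_ball] pdx_def fst_conv snd_conv
    using centre_in_ball[of "fst z" r] r(1) by blast
  have "sphere (fst z) r \<times> ball (snd z) r \<subseteq> S" using sub by auto
  then have "continuous_on ?U (\<lambda>w. cauchy_x (pdy f) (fst z) r (fst w) (snd w))"
    by (intro cauchy_x_continuous r(1) continuous_on_subset[OF continuous_on_pdy[OF f S]])
  then have "has_partials (pdx f) a (cauchy_x (pdy f) (fst z) r (fst z) (snd z)) z"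
    using r(1) by (intro has_partialsI[of ?U z, OF _ _ a] pdx_deriv_y[OF f S sub r(1)])
      (auto simp: open_Times mem_Times_iff)
  then show "\<exists>a b. has_partials (pdx f) a b z" by blast
qed

lemma hol2_pdy:
  assumes f: "hol2 f S" and S: "open S"
  shows "hol2 (pdy f) S"
proof -
  have "hol2 (pdx (f \<circ> prod.swap) \<circ> prod.swap) (prod.swap -` prod.swap -` S)"
    by (intro hol2_swap hol2_pdx open_swap assms)
  then show ?thesis by (simp add: pdy_swap[abs_def] o_def vimage_def)
qed

lemma pdx_pdy_commute:
  assumes f: "hol2 f S" and S: "open S" and z: "z \<in> S"
  shows "pdx (pdy f) z = pdy (pdx f) z"
proof -
  obtain r where r: "r > 0" "cball (fst z) r \<times> cball (snd z) r \<subseteq> S"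
    using open_contains_bidisc[OF S z] by blast
  then have sub: "cball (fst z) r \<times> ball (snd z) r \<subseteq> S" by auto
  show ?thesis
    using pdx_eq_cauchy_x[OF hol2_pdy[OF f S] sub, of "fst z" "snd z"]
      DERIV_imp_deriv[OF pdx_deriv_y[OF f S sub r(1), of "fst z" "snd z"]] r(1)
    by (simp add: pdy_def)
qed



section \<open>Identity theorem\<close>

text \<open>The property of vanishing near a point spreads over every ball in \<open>D\<close>: two points of a ball are
joined by a complex line, which meets the ball in a convex and hence connected set, and on that line the
identity theorem in one variable applies. Connectedness of \<open>D\<close> does the rest.\<close>

lemma hol2_identity:
  assumes f: "hol2 f D" and D: "open D" "connected D"
    and V: "open V" "V \<noteq> {}" "V \<subseteq> D" and zero: "\<And>z. z \<in> V \<Longrightarrow> f z = 0"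
    and z: "z \<in> D"
  shows "f z = 0"
proof -
  define P where "P z \<longleftrightarrow> (\<exists>N. open N \<and> z \<in> N \<and> (\<forall>w\<in>N. f w = 0))" for z
  obtain v where v: "v \<in> V" using V(2) by blast
  have "P z"
  proof (rule connected_induction_simple[OF D(2)])
    show "v \<in> D" "z \<in> D" "P v" using v V zero z by (auto simp: P_def)
    fix a assume "a \<in> D"
    then obtain r where r: "r > 0" "ball a r \<subseteq> D" using D(1) open_contains_ball by blast
    have spread: "f y = 0" if x: "x \<in> ball a r" "P x" and y: "y \<in> ball a r" for x y
    proof -
      obtain N where N: "open N" "x \<in> N" "\<forall>w\<in>N. f w = 0" using x(2) unfolding P_def by blast
      define l where "l t = (fst x + t * (fst y - fst x), snd x + t * (snd y - snd x))" for t
      have l: "continuous_on UNIV l" unfolding l_def by (intro continuous_intros)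
      have l01: "l 0 = x" "l 1 = y" by (simp_all add: l_def)
      define s' where "s' = l -` ball a r"
      define s where "s = l -` (N \<inter> ball a r)"
      have o: "open s'" "open s"
        unfolding s_def s'_def by (intro open_vimage l open_ball open_Int N(1))+
      have "convex s'"
      proof (rule convexI)
        fix t1 t2 and u v :: real assume u: "t1 \<in> s'" "t2 \<in> s'" "0 \<le> u" "0 \<le> v" "u + v = 1"
        have v: "v = 1 - u" using u(5) by simp
        have "l (u *\<^sub>R t1 + v *\<^sub>R t2) = u *\<^sub>R l t1 + v *\<^sub>R l t2"
          unfolding v by (simp add: l_def scaleR_conv_of_real algebra_simps)
        then show "u *\<^sub>R t1 + v *\<^sub>R t2 \<in> s'"
          using u convexD[OF convex_ball[of a r], of "l t1" "l t2" u v] by (simp add: s'_def)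
      qed
      have "((\<lambda>t. f (l t)) has_field_derivative
          pdx f (l t) * (fst y - fst x) + pdy f (l t) * (snd y - snd x)) (at t)" if "t \<in> s'" for t
      proof -
        have "l t \<in> D" using that r by (auto simp: s'_def)
        from hol2D[OF f this] show ?thesis
          unfolding l_def by (rule has_partials_along_curve) (auto intro!: derivative_eq_intros)
      qed
      then have hol: "(\<lambda>t. f (l t)) holomorphic_on s'"
        using o by (auto simp: holomorphic_on_open)
      have "f (l 1) = 0"
      proof (rule analytic_continuation_open[OF o(2,1) _ convex_connected[OF \<open>convex s'\<close>] _ hol holomorphic_on_const])
        show "s \<noteq> {}" using l01 N(2) x(1) by (auto simp: s_def intro: exI[of _ 0])
        show "1 \<in> s'" using y by (simp add: s'_def l01)
      qed (use N(3) in \<open>auto simp: s_def s'_def\<close>)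
      then show ?thesis by (simp add: l01)
    qed
    show "\<exists>T. openin (top_of_set D) T \<and> a \<in> T \<and> (\<forall>x\<in>T. \<forall>y\<in>T. P x \<longrightarrow> P y)"
    proof (intro exI conjI ballI impI)
      show "openin (top_of_set D) (ball a r)" using r D(1) by (simp add: openin_open_eq)
      show "a \<in> ball a r" using r by simp
      fix x y assume "x \<in> ball a r" "y \<in> ball a r" "P x"
      then show "P y"
        unfolding P_def[of y] using spread by (intro exI[of _ "ball a r"]) auto
    qed
  qed
  then show ?thesis by (auto simp: P_def)
qed

section \<open>Primitives of closed 1-forms on a ball\<close>

definition radial :: "point \<Rightarrow> real \<Rightarrow> point \<Rightarrow> point" where
  "radial q s z = (fst q + of_real s * (fst z - fst q), snd q + of_real s * (snd z - snd q))"

definition radial_integral :: "point \<Rightarrow> (point \<Rightarrow> complex) \<Rightarrow> (point \<Rightarrow> complex) \<Rightarrow> point \<Rightarrow> complex" where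
  "radial_integral q a b z = integral (cbox 0 1)
     (\<lambda>s. a (radial q s z) * (fst z - fst q) + b (radial q s z) * (snd z - snd q))"

lemma radial_in_ball:
  assumes "z \<in> ball q r" "s \<in> cbox 0 1"
  shows "radial q s z \<in> ball q r"
proof -
  have "radial q s z = q + s *\<^sub>R (z - q)"
    by (simp add: radial_def prod_eq_iff scaleR_conv_of_real)
  then have "dist q (radial q s z) = s * dist q z"
    using assms(2) by (simp add: dist_norm norm_minus_commute)
  also have "\<dots> \<le> 1 * dist q z"
    using assms(2) by (intro mult_right_mono) auto
  finally show ?thesis using assms(1) by simp
qed

lemma continuous_on_radial: "continuous_on X g \<Longrightarrow> continuous_on X h \<Longrightarrow> continuous_on X (\<lambda>p. radial q (g p) (h p))"
  unfolding radial_def by (intro continuous_intros)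

text \<open>Differentiating under the integral sign and using \<open>\<partial>b/\<partial>x = \<partial>a/\<partial>y\<close>, the integrand becomes the derivative of
\<open>s \<mapsto> s a(q + s (z - q))\<close>, whose integral over the unit interval is \<open>a z\<close>.\<close>

lemma radial_integral_deriv_x:
  assumes a: "hol2 a (ball q r)" and b: "hol2 b (ball q r)"
    and closed: "\<And>z. z \<in> ball q r \<Longrightarrow> pdx b z = pdy a z" and z: "(x, y) \<in> ball q r"
  shows "((\<lambda>x. radial_integral q a b (x, y)) has_field_derivative a (x, y)) (at x)"
proof -
  define U where "U = (\<lambda>x. (x, y)) -` ball q r"
  define g where "g x s = of_real s * pdx a (radial q s (x, y)) * (x - fst q) + a (radial q s (x, y))
      + of_real s * pdx b (radial q s (x, y)) * (y - snd q)" for x s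
  have U: "open U" "convex U" "x \<in> U"
  proof -
    show "open U" unfolding U_def by (intro open_vimage open_ball continuous_intros)
    show "x \<in> U" using z by (simp add: U_def)
    show "convex U"
    proof (rule convexI)
      fix x1 x2 and u v :: real assume u: "x1 \<in> U" "x2 \<in> U" "0 \<le> u" "0 \<le> v" "u + v = 1"
      have v: "v = 1 - u" using u(5) by simp
      have "(u *\<^sub>R x1 + v *\<^sub>R x2, y) = u *\<^sub>R (x1, y) + v *\<^sub>R (x2, y)"
        unfolding v by (simp add: algebra_simps)
      then show "u *\<^sub>R x1 + v *\<^sub>R x2 \<in> U"
        using u convexD[OF convex_ball[of q r], of "(x1, y)" "(x2, y)" u v] by (simp add: U_def)
    qed
  qed
  have rb: "radial q s (x, y) \<in> ball q r" if "x \<in> U" "s \<in> cbox 0 1" for x s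
    using that by (intro radial_in_ball) (auto simp: U_def)
  have cont: "continuous_on (U \<times> cbox 0 1) (\<lambda>p. f (radial q (snd p) (fst p, y)))"
    if "continuous_on (ball q r) f" for f :: "point \<Rightarrow> complex"
    by (rule continuous_on_compose2[OF that continuous_on_radial])
      (use rb in \<open>auto intro!: continuous_intros\<close>)
  have slice: "continuous_on (cbox 0 1) (\<lambda>s. f (radial q s (x, y)))"
    if "continuous_on (ball q r) f" "x \<in> U" for f :: "point \<Rightarrow> complex" and x
    by (rule continuous_on_compose2[OF that(1) continuous_on_radial])
      (use rb that(2) in \<open>auto intro!: continuous_intros\<close>)
  note ca = hol2_continuous_on[OF a] and cb = hol2_continuous_on[OF b]
    and cax = continuous_on_pdx[OF a open_ball] and cbx = continuous_on_pdx[OF b open_ball]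
  have "((\<lambda>x. radial_integral q a b (x, y)) has_field_derivative integral (cbox 0 1) (g x)) (at x within U)"
    unfolding radial_integral_def fst_conv snd_conv
  proof (rule leibniz_rule_field_derivative[OF _ _ _ U(3,2)])
    fix x s assume x: "x \<in> U" and s: "s \<in> cbox (0::real) 1"
    have d: "((\<lambda>x. f (radial q s (x, y))) has_field_derivative pdx f (radial q s (x, y)) * of_real s) (at x)"
      if "hol2 f (ball q r)" for f
    proof -
      have "((\<lambda>x. f (fst q + of_real s * (x - fst q), snd q + of_real s * (y - snd q)))
         has_field_derivative pdx f (radial q s (x, y)) * of_real s + pdy f (radial q s (x, y)) * 0) (at x)"
        using hol2D[OF that rb[OF x s]]
        by (intro has_partials_along_curve) (auto simp: radial_def intro!: derivative_eq_intros)
      then show ?thesis by (simp add: radial_def)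
    qed
    show "((\<lambda>x. a (radial q s (x, y)) * (x - fst q) + b (radial q s (x, y)) * (y - snd q))
        has_field_derivative g x s) (at x within U)"
      unfolding g_def
      by (rule has_field_derivative_at_within)
        (auto intro!: derivative_eq_intros d[OF a] d[OF b] simp: algebra_simps)
  next
    fix x assume x: "x \<in> U"
    show "(\<lambda>s. a (radial q s (x, y)) * (x - fst q) + b (radial q s (x, y)) * (y - snd q)) integrable_on cbox 0 1"
      by (intro integrable_continuous continuous_intros slice ca cb x)
  next
    show "continuous_on (U \<times> cbox 0 1) (\<lambda>(x, s). g x s)"
      unfolding g_def split_beta by (intro continuous_intros cont ca cax cbx)
  qed
  then have "((\<lambda>x. radial_integral q a b (x, y)) has_field_derivative integral (cbox 0 1) (g x)) (at x)"
    by (simp only: at_within_open[OF U(3,1)])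
  moreover have "(g x has_integral of_real 1 * a (radial q 1 (x, y)) - of_real 0 * a (radial q 0 (x, y))) {0..1}"
  proof (rule fundamental_theorem_of_calculus[where f = "\<lambda>s. of_real s * a (radial q s (x, y))"])
    fix s :: real assume "s \<in> {0..1}"
    then have rs: "radial q s (x, y) \<in> ball q r" using rb U(3) by auto
    have "((\<lambda>t. t * a (fst q + t * (x - fst q), snd q + t * (y - snd q))) has_field_derivative
      of_real s * (pdx a (radial q s (x, y)) * (x - fst q) + pdy a (radial q s (x, y)) * (y - snd q))
       + a (radial q s (x, y))) (at (of_real s))"
    proof -
      have "((\<lambda>t. a (fst q + t * (x - fst q), snd q + t * (y - snd q))) has_field_derivative
          pdx a (radial q s (x, y)) * (x - fst q) + pdy a (radial q s (x, y)) * (y - snd q)) (at (of_real s))"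
        using hol2D[OF a rs]
        by (intro has_partials_along_curve) (auto simp: radial_def intro!: derivative_eq_intros)
      then show ?thesis
        by (auto simp: radial_def intro!: derivative_eq_intros)
    qed
    from has_vector_derivative_real_field[OF this]
    show "((\<lambda>s. of_real s * a (radial q s (x, y))) has_vector_derivative g x s) (at s within {0..1})"
      using closed[OF rs] by (simp add: g_def radial_def algebra_simps)
  qed simp
  then have "integral (cbox 0 1) (g x) = a (x, y)"
    by (simp add: integral_unique radial_def)
  ultimately show ?thesis by simp
qed

text \<open>The Poincare lemma. The derivative in \<open>y\<close> follows from the one in \<open>x\<close> by exchanging the
coordinates together with the two coefficients, which leaves the integral unchanged.\<close>

lemma closed_form_primitive:
  assumes a: "hol2 a (ball q r)" and b: "hol2 b (ball q r)"
    and closed: "\<And>z. z \<in> ball q r \<Longrightarrow> pdx b z = pdy a z" and z: "z \<in> ball q r"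
  shows "has_partials (radial_integral q a b) (a z) (b z) z"
proof (rule has_partialsI[of "ball q r" z _ _ b])
  show "((\<lambda>x. radial_integral q a b (x, snd z)) has_field_derivative a z) (at (fst z))"
    using radial_integral_deriv_x[OF a b closed, of "fst z" "snd z"] z by simp
  fix w assume w: "w \<in> ball q r"
  have sw: "prod.swap -` ball q r = ball (prod.swap q) r"
    by (cases q) (auto simp: dist_Pair_Pair add.commute)
  have "((\<lambda>y. radial_integral (prod.swap q) (b \<circ> prod.swap) (a \<circ> prod.swap) (y, fst w))
      has_field_derivative (b \<circ> prod.swap) (snd w, fst w)) (at (snd w))"
  proof (rule radial_integral_deriv_x)
    show "hol2 (b \<circ> prod.swap) (ball (prod.swap q) r)" "hol2 (a \<circ> prod.swap) (ball (prod.swap q) r)"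
      using hol2_swap[OF a] hol2_swap[OF b] by (simp_all add: sw)
    fix v assume "v \<in> ball (prod.swap q) r"
    then have "prod.swap v \<in> ball q r" using sw by blast
    from closed[OF this] show "pdx (a \<circ> prod.swap) v = pdy (b \<circ> prod.swap) v"
      by (simp add: pdx_def pdy_def)
  next
    show "(snd w, fst w) \<in> ball (prod.swap q) r"
      using w unfolding sw[symmetric] by simp
  qed
  then show "((\<lambda>y. radial_integral q a b (fst w, y)) has_field_derivative b w) (at (snd w))"
    by (simp add: radial_integral_def radial_def add.commute)
qed (use z hol2_continuous_on[OF b] in auto)

section \<open>First integrals\<close>

text \<open>Along the local graphs that make up a leaf, the chain rule turns the hypothesis into a vanishing
derivative, so \<open>I\<close> is locally constant on the leaf, which is connected.\<close>

lemma first_integralI: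
  assumes I: "hol2 I W" and tangent: "\<And>z. z \<in> W \<Longrightarrow> pdx I z + p z * pdy I z = 0"
  shows "first_integral p W I"
  unfolding first_integral_def
proof (intro conjI allI impI I)
  fix L assume "foliation_leaf p W L"
  then have "connected L" and graph: "\<forall>z\<in>L. \<exists>N S f. open N \<and> z \<in> N \<and> open S \<and> f holomorphic_on S \<and>
        (\<forall>x\<in>S. (x, f x) \<in> W \<and> deriv f x = p (x, f x)) \<and> L \<inter> N = (\<lambda>x. (x, f x)) ` S"
    unfolding foliation_leaf_def leaf_def by auto
  show "I constant_on L"
  proof (rule locally_constant_imp_constant[OF \<open>connected L\<close>])
    fix z assume "z \<in> L"
    from bspec[OF graph this] obtain N S f where
      "open N \<and> z \<in> N \<and> open S \<and> f holomorphic_on S \<and>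
        (\<forall>x\<in>S. (x, f x) \<in> W \<and> deriv f x = p (x, f x)) \<and> L \<inter> N = (\<lambda>x. (x, f x)) ` S"
      by (elim exE)
    then have N: "open N" "z \<in> N" "open S" "f holomorphic_on S"
      "\<And>x. x \<in> S \<Longrightarrow> (x, f x) \<in> W \<and> deriv f x = p (x, f x)" "L \<inter> N = (\<lambda>x. (x, f x)) ` S"
      by auto
    have "z \<in> (\<lambda>x. (x, f x)) ` S"
      using N(2,6) \<open>z \<in> L\<close> by blast
    then have zS: "fst z \<in> S" "z = (fst z, f (fst z))" by auto
    then obtain e where e: "e > 0" "ball (fst z) e \<subseteq> S" using N(3) open_contains_ball by blast
    have "((\<lambda>x. I (x, f x)) has_field_derivative 0) (at x)" if "x \<in> S" for x
    proof -
      have "(f has_field_derivative deriv f x) (at x)"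
        using N(3,4) that holomorphic_derivI by blast
      moreover have W: "(x, f x) \<in> W" and slope: "deriv f x = p (x, f x)" using N(5)[OF that] by auto
      ultimately have "((\<lambda>x. I (x, f x)) has_field_derivative
          pdx I (x, f x) * 1 + pdy I (x, f x) * p (x, f x)) (at x)"
        using hol2D[OF I W] by (intro has_partials_along_curve) auto
      then show ?thesis using tangent[OF W] by (simp add: mult.commute)
    qed
    then obtain c where c: "\<forall>x\<in>ball (fst z) e. I (x, f x) = c"
      using has_field_derivative_zero_constant[OF convex_ball[of "fst z" e], of "\<lambda>x. I (x, f x)"] e(2)
      by (meson has_field_derivative_at_within subsetD)
    show "\<exists>T. openin (top_of_set L) T \<and> z \<in> T \<and> (\<forall>x\<in>T. I x = I z)"
    proof (intro exI conjI)
      have "open (fst -` ball (fst z) e :: point set)" by (intro open_vimage open_ball continuous_intros)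
      then show "openin (top_of_set L) (L \<inter> (N \<inter> fst -` ball (fst z) e))"
        using N(1) by (intro openin_open_Int open_Int)
      show "z \<in> L \<inter> (N \<inter> fst -` ball (fst z) e)" using \<open>z \<in> L\<close> N(2) e(1) by simp
      show "\<forall>x\<in>L \<inter> (N \<inter> fst -` ball (fst z) e). I x = I z"
      proof
        fix w assume w: "w \<in> L \<inter> (N \<inter> fst -` ball (fst z) e)"
        then have "w \<in> (\<lambda>x. (x, f x)) ` S" using N(6) by blast
        then have "w = (fst w, f (fst w))" by auto
        then have "I w = c" using c w by (metis IntD2 vimageD)
        moreover have "I z = c" using c zS(2) e(1) by (metis centre_in_ball)
        ultimately show "I w = I z" by simp
      qed
    qed
  qed
qed



section \<open>Holomorphic roots of a depressed cubic\<close>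

lemma depressed_cubic_factors:
  fixes a b :: complex
  obtains r1 r2 r3 where "r1 + r2 + r3 = 0" "a = r1 * r2 + r2 * r3 + r3 * r1" "b = - r1 * r2 * r3"
    "\<And>t. t ^ 3 + a * t + b = (t - r1) * (t - r2) * (t - r3)"
proof -
  obtain r1 where "poly [:b, a, 0, 1:] r1 = 0"
    using alg_closed_imp_poly_has_root[of "[:b, a, 0, 1:]"] by auto
  then have r1: "b = - (r1 ^ 3 + a * r1)"
    by (simp add: power3_eq_cube algebra_simps) algebra
  define s where "s = csqrt (r1 ^ 2 - 4 * (r1 ^ 2 + a))"
  define r2 where "r2 = (- r1 + s) / 2"
  define r3 where "r3 = - r1 - r2"
  have "s ^ 2 = r1 ^ 2 - 4 * (r1 ^ 2 + a)" by (simp add: s_def)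
  moreover have "s = 2 * r2 + r1" by (simp add: r2_def field_simps)
  ultimately have "(2 * r2 + r1) ^ 2 = r1 ^ 2 - 4 * (r1 ^ 2 + a)" by simp
  then have "4 * (a - (r1 * r2 + r2 * r3 + r3 * r1)) = 0" unfolding r3_def by algebra
  then have a: "a = r1 * r2 + r2 * r3 + r3 * r1" unfolding mult_eq_0_iff by simp
  have b: "b = - r1 * r2 * r3" unfolding r1 a r3_def by algebra
  show ?thesis
    by (rule that[OF _ a b]) (unfold a b r3_def, algebra+)
qed

text \<open>The value of the cubic at \<open>t\<close> is the product of the three differences \<open>t - r\<^sub>j\<close>, and the least of their
moduli is at most the geometric mean. This quantitative statement yields both existence and
continuity of the roots.\<close>

lemma depressed_cubic_root_near:
  fixes a b t :: complex
  obtains r where "r ^ 3 + a * r + b = 0" "norm (t - r) ^ 3 \<le> norm (t ^ 3 + a * t + b)"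
proof -
  obtain r1 r2 r3 where r: "\<And>t. t ^ 3 + a * t + b = (t - r1) * (t - r2) * (t - r3)"
    by (rule depressed_cubic_factors[of a b]) (rule that)
  have le: "x ^ 3 \<le> x * y * z" if "0 \<le> x" "x \<le> y" "x \<le> z" for x y z :: real
    using that by (simp add: power3_eq_cube mult_mono)
  let ?x = "norm (t - r1)" and ?y = "norm (t - r2)" and ?z = "norm (t - r3)"
  have n: "norm (t ^ 3 + a * t + b) = ?x * ?y * ?z" by (simp add: r norm_mult)
  consider "?x \<le> ?y \<and> ?x \<le> ?z" | "?y \<le> ?x \<and> ?y \<le> ?z" | "?z \<le> ?x \<and> ?z \<le> ?y" by linarith
  then show ?thesis
  proof cases
    case 1 then show ?thesis using le[of ?x ?y ?z] by (intro that[of r1]) (simp add: r, simp add: n)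
  next
    case 2 then show ?thesis using le[of ?y ?x ?z] by (intro that[of r2]) (simp add: r, simp add: n mult_ac)
  next
    case 3 then show ?thesis using le[of ?z ?x ?y] by (intro that[of r3]) (simp add: r, simp add: n mult_ac)
  qed
qed

text \<open>A product rule for a factor \<open>g\<close> that is only continuous; it holds because the other factor vanishes at
the point.\<close>

lemma has_partials_mult_vanishing:
  assumes N: "has_partials N a b w" "N w = 0" and g: "isCont g w"
  shows "has_partials (\<lambda>z. N z * g z) (a * g w) (b * g w) w"
proof -
  define L where "L h = a * fst h + b * snd h" for h
  have d: "bounded_linear L" "((\<lambda>z. norm (N z - L (z - w)) / norm (z - w)) \<longlongrightarrow> 0) (at w)"
    using N unfolding has_partials_def L_def[symmetric] has_derivative_iff_norm by simp_all
  obtain K where K: "\<And>h. norm (L h) \<le> norm h * K"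
    using bounded_linear.bounded[OF d(1)] by blast
  have g0: "((\<lambda>z. norm (g z - g w)) \<longlongrightarrow> 0) (at w)"
    using g by (simp add: isCont_def LIM_zero tendsto_norm_zero)
  have lim: "((\<lambda>z. norm (N z - L (z - w)) / norm (z - w) * norm (g z) + K * norm (g z - g w)) \<longlongrightarrow> 0) (at w)"
  proof -
    have "((\<lambda>z. norm (N z - L (z - w)) / norm (z - w) * norm (g z) + K * norm (g z - g w))
        \<longlongrightarrow> 0 * norm (g w) + K * 0) (at w)"
      using g by (intro tendsto_intros d(2) g0) (simp add: isCont_def)
    then show ?thesis by simp
  qed
  have "((\<lambda>z. norm (N z * g z - N w * g w - L (z - w) * g w) / norm (z - w)) \<longlongrightarrow> 0) (at w)"
  proof (rule Lim_null_comparison[OF _ lim])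
    show "\<forall>\<^sub>F z in at w. norm (norm (N z * g z - N w * g w - L (z - w) * g w) / norm (z - w))
        \<le> norm (N z - L (z - w)) / norm (z - w) * norm (g z) + K * norm (g z - g w)"
      unfolding eventually_at_filter
    proof (rule always_eventually, intro allI impI)
      fix z assume "z \<noteq> w"
      then have pos: "norm (z - w) > 0" by simp
      have "N z * g z - N w * g w - L (z - w) * g w = (N z - L (z - w)) * g z + L (z - w) * (g z - g w)"
        using N(2) by (simp add: algebra_simps)
      then have "norm (N z * g z - N w * g w - L (z - w) * g w)
          \<le> norm (N z - L (z - w)) * norm (g z) + norm (L (z - w)) * norm (g z - g w)"
        by (metis norm_triangle_ineq norm_mult)
      also have "\<dots> \<le> norm (N z - L (z - w)) * norm (g z) + norm (z - w) * K * norm (g z - g w)"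
        by (intro add_left_mono mult_right_mono K) simp
      finally show "norm (norm (N z * g z - N w * g w - L (z - w) * g w) / norm (z - w))
        \<le> norm (N z - L (z - w)) / norm (z - w) * norm (g z) + K * norm (g z - g w)"
        using pos by (simp add: field_simps)
    qed
  qed
  moreover have "bounded_linear (\<lambda>h. L h * g w)"
    using d(1) by (rule bounded_linear_mult_const)
  ultimately show ?thesis
    unfolding has_partials_def has_derivative_iff_norm by (simp add: L_def algebra_simps)
qed

text \<open>The implicit function theorem for a simple root. If \<open>F z t = t\<^sup>3 + A z t + B z\<close>, then \<open>F z s - F z t\<close> is
\<open>s - t\<close> times \<open>s\<^sup>2 + st + t\<^sup>2 + A z\<close>. The second factor is \<open>3r\<^sup>2 + A q \<noteq> 0\<close> at \<open>z = q\<close>, \<open>s = t = r\<close>, hence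
nonzero nearby; this makes the root near \<open>r\<close> unique. Existence and continuity come from
\<open>depressed_cubic_root_near\<close>. Solving \<open>F z (f z) = F w (f w)\<close> for \<open>f z - f w\<close> then shows that \<open>f\<close> is
differentiable.\<close>

lemma holomorphic_simple_root:
  assumes A: "hol2 A D" and B: "hol2 B D" and D: "open D" "q \<in> D"
    and r: "r ^ 3 + A q * r + B q = 0" "3 * r ^ 2 + A q \<noteq> 0"
  obtains V f where "open V" "q \<in> V" "V \<subseteq> D" "hol2 f V" "f q = r"
    "\<And>z. z \<in> V \<Longrightarrow> f z ^ 3 + A z * f z + B z = 0"
proof -
  note cA = hol2_continuous_on[OF A] and cB = hol2_continuous_on[OF B]
  let ?G = "\<lambda>z s t. s ^ 2 + s * t + t ^ 2 + A z"
  let ?O = "{p \<in> D \<times> UNIV. ?G (fst p) (fst (snd p)) (snd (snd p)) \<noteq> 0}"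
  have "open ?O"
  proof -
    have "continuous_on (D \<times> UNIV) (\<lambda>p. ?G (fst p) (fst (snd p)) (snd (snd p)))"
      by (intro continuous_intros continuous_on_compose2[OF cA]) auto
    from continuous_open_preimage[OF this open_Times[OF D(1) open_UNIV] open_Compl[OF closed_singleton[of 0]]]
    show ?thesis by (rule back_subst[where P = "open"]) auto
  qed
  moreover have "(q, r, r) \<in> ?O" using r(2) D(2) by (simp add: power2_eq_square algebra_simps)
  ultimately obtain V1 Y where V1: "open V1" "open Y" "(q, r, r) \<in> V1 \<times> Y" "V1 \<times> Y \<subseteq> ?O"
    by (rule open_prod_elim)
  obtain Y1 Y2 where Y: "open Y1" "open Y2" "(r, r) \<in> Y1 \<times> Y2" "Y1 \<times> Y2 \<subseteq> Y"
    using open_prod_elim[OF V1(2), of "(r, r)"] V1(3) by auto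
  have "open (Y1 \<inter> Y2)" "r \<in> Y1 \<inter> Y2" using Y by auto
  then obtain e where e: "e > 0" "ball r e \<subseteq> Y1 \<inter> Y2" using open_contains_ball by blast
  have G: "z \<in> D \<and> ?G z s t \<noteq> 0" if "z \<in> V1" "s \<in> ball r e" "t \<in> ball r e" for z s t
  proof -
    have "(s, t) \<in> Y" using that e(2) Y(4) by blast
    then have "(z, s, t) \<in> ?O" using that(1) V1(4) by blast
    then show ?thesis by simp
  qed
  have V1D: "V1 \<subseteq> D" using G[of _ r r] e(1) by (auto simp del: mem_ball simp: centre_in_ball)
  define F where "F z t = t ^ 3 + A z * t + B z" for z t
  have unique: "s = t" if "z \<in> V1" "s \<in> ball r e" "t \<in> ball r e" "F z s = 0" "F z t = 0" for z s t
  proof -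
    have "(s - t) * ?G z s t = F z s - F z t" unfolding F_def by algebra
    then show ?thesis using G[OF that(1-3)] that(4,5) by simp
  qed
  have cF: "continuous_on V1 (\<lambda>z. F z t)" for t
    unfolding F_def
    by (intro continuous_intros continuous_on_subset[OF cA V1D] continuous_on_subset[OF cB V1D])
  \<comment> \<open>On this set a root at distance less than \<open>e\<close> from \<open>r\<close> exists.\<close>
  define V where "V = {z \<in> V1. norm (F z r) < e ^ 3}"
  have "open V"
    using continuous_open_preimage[OF continuous_on_norm[OF cF[of r]] V1(1) open_lessThan[of "e ^ 3"]]
    by (rule back_subst[where P = "open"]) (auto simp: V_def)
  have near: "\<exists>s\<in>ball t d. F z s = 0" if "norm (F z t) < d ^ 3" "d > 0" for z t d
  proof -
    obtain s where s: "s ^ 3 + A z * s + B z = 0" "norm (t - s) ^ 3 \<le> norm (t ^ 3 + A z * t + B z)"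
      by (rule depressed_cubic_root_near)
    then have "norm (t - s) ^ 3 < d ^ 3" using that by (simp add: F_def)
    then have "norm (t - s) < d" using that(2) by (meson less_imp_le power_less_imp_less_base)
    then show ?thesis using s(1) by (auto simp: F_def dist_norm)
  qed
  define f where "f z = (SOME s. s \<in> ball r e \<and> F z s = 0)" for z
  have f: "f z \<in> ball r e" "F z (f z) = 0" if "z \<in> V" for z
  proof -
    have "\<exists>s. s \<in> ball r e \<and> F z s = 0" using near[of z r e] that e(1) by (auto simp: V_def)
    from someI_ex[OF this] show "f z \<in> ball r e" "F z (f z) = 0" unfolding f_def by blast+
  qed
  have VD: "V \<subseteq> D" "V \<subseteq> V1" using G[of _ r r] e(1) by (auto simp: V_def)
  have cont: "isCont f w" if w: "w \<in> V" for w
    unfolding isCont_def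
  proof (rule tendstoI)
    fix d :: real assume "d > 0"
    obtain d' where d': "d' > 0" "ball (f w) d' \<subseteq> ball r e"
      using f(1)[OF w] open_contains_ball open_ball by blast
    define m where "m = min d d'"
    have m: "m > 0" using d' \<open>d > 0\<close> by (simp add: m_def)
    have "continuous_on V (\<lambda>z. norm (F z (f w)))"
      using continuous_on_subset[OF cF VD(2)] by (rule continuous_on_norm)
    then have "isCont (\<lambda>z. norm (F z (f w))) w"
      using w \<open>open V\<close> by (simp add: continuous_on_eq_continuous_at)
    then have "((\<lambda>z. norm (F z (f w))) \<longlongrightarrow> 0) (at w)"
      using f(2)[OF w] by (simp add: isCont_def)
    then have "\<forall>\<^sub>F z in at w. norm (F z (f w)) < m ^ 3"
      using m by (intro order_tendstoD(2)) auto
    moreover have "\<forall>\<^sub>F z in at w. z \<in> V"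
      using \<open>open V\<close> w by (rule eventually_at_in_open')
    ultimately show "\<forall>\<^sub>F z in at w. dist (f z) (f w) < d"
    proof eventually_elim
      case (elim z)
      obtain s where s: "s \<in> ball (f w) m" "F z s = 0" using near[OF elim(1) m] by blast
      then have "s \<in> ball r e" using d' by (auto simp: m_def)
      then have "s = f z" using unique[of z s "f z"] f elim(2) s(2) VD by blast
      then show ?case using s(1) by (simp add: m_def dist_commute)
    qed
  qed
  have "hol2 f V"
    unfolding hol2_def has_partials_def[symmetric]
  proof
    fix w assume w: "w \<in> V"
    \<comment> \<open>Subtracting the equations at \<open>z\<close> and \<open>w\<close> gives \<open>f z - f w = N z g z\<close>, where \<open>N\<close> is differentiable
      and vanishes at \<open>w\<close>, while \<open>g\<close> is so far only known to be continuous.\<close>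
    let ?N = "\<lambda>z. (A w - A z) * f w + (B w - B z)"
    let ?g = "\<lambda>z. inverse (?G z (f z) (f w))"
    have wD: "w \<in> D" using w VD by blast
    have "has_partials ?N ((0 - pdx A w) * f w + (A w - A w) * 0 + (0 - pdx B w))
        ((0 - pdy A w) * f w + (A w - A w) * 0 + (0 - pdy B w)) w"
      by (intro has_partials_intros hol2D[OF A wD] hol2D[OF B wD])
    moreover have "isCont ?g w"
    proof -
      have "isCont A w" using cA D(1) wD by (simp add: continuous_on_eq_continuous_at)
      then show ?thesis
        using cont[OF w] G[of w "f w" "f w"] f[OF w] w VD by (intro continuous_intros) auto
    qed
    ultimately have "\<exists>a b. has_partials (\<lambda>z. ?N z * ?g z) a b w"
      using has_partials_mult_vanishing[of ?N _ _ w ?g] by auto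
    then obtain a b where "has_partials (\<lambda>z. f w + ?N z * ?g z) (0 + a) (0 + b) w"
      using has_partials_add[OF has_partials_const] by blast
    then have "has_partials f (0 + a) (0 + b) w"
    proof (rule has_partials_cong[OF _ \<open>open V\<close> w])
      fix z assume z: "z \<in> V"
      have "?G z (f z) (f w) \<noteq> 0" using G[of z "f z" "f w"] z w f VD by auto
      moreover have "(f z - f w) * ?G z (f z) (f w) = ?N z"
        using f(2)[OF z] f(2)[OF w] unfolding F_def by algebra
      ultimately have "?N z * ?g z = f z - f w" by (metis (no_types) mult.assoc mult.right_neutral right_inverse)
      then show "f w + ?N z * ?g z = f z" by simp
    qed
    then show "\<exists>a b. has_partials f a b w" by blast
  qed
  moreover have "q \<in> V" using V1(3) r(1) e(1) by (simp add: V_def F_def)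
  moreover have "f q = r"
    using unique[of q "f q" r] f[OF \<open>q \<in> V\<close>] V1(3) e(1) r(1) by (simp add: F_def)
  ultimately show ?thesis
    using that[of V f] \<open>open V\<close> VD(1) f(2) by (simp add: F_def)
qed

lemma web_roots_distinct:
  assumes "web_roots A B V p" "z \<in> V" "i \<noteq> j"
  shows "p i z \<noteq> p j z"
  using assms unfolding web_roots_def inj_def by metis

lemma holomorphic_web_roots:
  assumes A: "hol2 A D" and B: "hol2 B D" and D: "open D" "q \<in> D"
    and disc: "4 * A q ^ 3 + 27 * B q ^ 2 \<noteq> 0"
  obtains V p where "open V" "q \<in> V" "V \<subseteq> D" "web_roots A B V p"
proof -
  obtain r1 r2 r3 where r: "r1 + r2 + r3 = 0" "A q = r1 * r2 + r2 * r3 + r3 * r1" "B q = - r1 * r2 * r3"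
    "\<And>t. t ^ 3 + A q * t + B q = (t - r1) * (t - r2) * (t - r3)"
    by (rule depressed_cubic_factors[of "A q" "B q"]) (rule that)
  have r3: "r3 = - r1 - r2" using r(1) by algebra
  have "4 * A q ^ 3 + 27 * B q ^ 2 = - (((r1 - r2) * (r2 - r3) * (r3 - r1)) ^ 2)"
    unfolding r(2,3) r3 by algebra
  with disc have dist: "r1 \<noteq> r2" "r2 \<noteq> r3" "r3 \<noteq> r1" by auto
  have d: "3 * r1 ^ 2 + A q = (r1 - r2) * (r1 - r3)" "3 * r2 ^ 2 + A q = (r2 - r1) * (r2 - r3)"
    "3 * r3 ^ 2 + A q = (r3 - r1) * (r3 - r2)"
    unfolding r(2) r3 by algebra+
  obtain V1 f1 where 1: "open V1" "q \<in> V1" "V1 \<subseteq> D" "hol2 f1 V1" "f1 q = r1"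
    "\<And>z. z \<in> V1 \<Longrightarrow> f1 z ^ 3 + A z * f1 z + B z = 0"
    by (rule holomorphic_simple_root[OF A B D, of r1]) (use r(4)[of r1] d(1) dist in simp_all)
  obtain V2 f2 where 2: "open V2" "q \<in> V2" "V2 \<subseteq> D" "hol2 f2 V2" "f2 q = r2"
    "\<And>z. z \<in> V2 \<Longrightarrow> f2 z ^ 3 + A z * f2 z + B z = 0"
    by (rule holomorphic_simple_root[OF A B D, of r2]) (use r(4)[of r2] d(2) dist in simp_all)
  obtain V3 f3 where 3: "open V3" "q \<in> V3" "V3 \<subseteq> D" "hol2 f3 V3" "f3 q = r3"
    "\<And>z. z \<in> V3 \<Longrightarrow> f3 z ^ 3 + A z * f3 z + B z = 0"
    by (rule holomorphic_simple_root[OF A B D, of r3]) (use r(4)[of r3] d(3) dist in simp_all)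
  define N where "N = V1 \<inter> V2 \<inter> V3"
  define V where "V = {z \<in> N. (f1 z - f2 z) * (f2 z - f3 z) * (f3 z - f1 z) \<noteq> 0}"
  have hol: "hol2 f1 N" "hol2 f2 N" "hol2 f3 N"
    using hol2_subset[OF 1(4), of N] hol2_subset[OF 2(4), of N] hol2_subset[OF 3(4), of N]
    by (auto simp: N_def)
  have oN: "open N" using 1 2 3 by (simp add: N_def open_Int)
  have "continuous_on N (\<lambda>z. (f1 z - f2 z) * (f2 z - f3 z) * (f3 z - f1 z))"
    by (intro continuous_intros hol2_continuous_on hol)
  from continuous_open_preimage[OF this oN open_Compl[OF closed_singleton[of 0]]]
  have "open V" by (rule back_subst[where P = "open"]) (auto simp: V_def)
  moreover have "q \<in> V" using 1 2 3 dist by (simp add: V_def N_def)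
  moreover have "V \<subseteq> D" using 1(3) by (auto simp: V_def N_def)
  moreover define p :: "3 \<Rightarrow> point \<Rightarrow> complex" where "p i = (if i = 1 then f1 else if i = 2 then f2 else f3)" for i
  have p: "p 1 = f1" "p 2 = f2" "p 3 = f3" by (simp_all add: p_def)
  have "web_roots A B V p"
    unfolding web_roots_def
  proof (intro conjI ballI)
    show "\<forall>i. hol2 (p i) V"
      unfolding forall_3 p using hol2_subset[of _ N V] hol by (auto simp: V_def)
    fix z assume z: "z \<in> V"
    then have "f1 z \<noteq> f2 z" "f2 z \<noteq> f3 z" "f3 z \<noteq> f1 z" by (auto simp: V_def)
    then show "inj (\<lambda>i. p i z)"
      unfolding inj_def forall_3 p by auto
    show "\<forall>i. p i z ^ 3 + A z * p i z + B z = 0"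
      unfolding forall_3 p using z 1(6) 2(6) 3(6) by (simp add: V_def N_def)
  qed
  ultimately show ?thesis by (rule that)
qed



section \<open>The Chern form in terms of the coefficients of the equation\<close>

text \<open>Two of the roots serve as coordinates: with these formulas every identity between symmetric
functions of the roots becomes a polynomial identity in two free variables.\<close>

lemma web_roots_vieta:
  assumes "web_roots A B V p" "z \<in> V"
  shows "p (i + 2) z = - p i z - p (i + 1) z"
    and "A z = - (p i z ^ 2 + p i z * p (i + 1) z + p (i + 1) z ^ 2)"
    and "B z = p i z * p (i + 1) z * (p i z + p (i + 1) z)"
proof -
  let ?P = "p i z" and ?Q = "p (i + 1) z" and ?R = "p (i + 2) z"
  have eqs: "?P ^ 3 + A z * ?P + B z = 0" "?Q ^ 3 + A z * ?Q + B z = 0" "?R ^ 3 + A z * ?R + B z = 0"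
    using assms by (auto simp: web_roots_def)
  have ne: "?P \<noteq> ?Q" "?Q \<noteq> ?R" "?P \<noteq> ?R"
    by (rule web_roots_distinct[OF assms]; simp)+
  have "(?P - ?Q) * (A z + (?P ^ 2 + ?P * ?Q + ?Q ^ 2)) = 0" using eqs(1,2) by algebra
  then show A: "A z = - (?P ^ 2 + ?P * ?Q + ?Q ^ 2)"
    using ne(1) by (simp add: add_eq_0_iff2)
  show B: "B z = ?P * ?Q * (?P + ?Q)" using eqs(1) unfolding A by algebra
  have "(?R - ?P) * ((?R - ?Q) * (?R + ?P + ?Q)) = 0" using eqs(3) unfolding A B by algebra
  then have "?R + ?P + ?Q = 0" using ne by simp
  then show "?R = - ?P - ?Q" by algebra
qed

lemma discriminant_at_web_roots:
  assumes "web_roots A B V p" "z \<in> V"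
  shows "4 * A z ^ 3 + 27 * B z ^ 2
    = - (((p i z - p (i + 1) z) * (p (i + 1) z - p (i + 2) z) * (p (i + 2) z - p i z)) ^ 2)"
  unfolding web_roots_vieta[OF assms, of i] by algebra

lemma discriminant_nonzero_at_web_roots:
  assumes "web_roots A B V p" "z \<in> V"
  shows "4 * A z ^ 3 + 27 * B z ^ 2 \<noteq> 0"
  unfolding discriminant_at_web_roots[OF assms, of 1]
  using web_roots_distinct[OF assms, of 1 2] web_roots_distinct[OF assms, of 2 3]
    web_roots_distinct[OF assms, of 3 1]
  by simp

lemma simple_at_web_roots:
  assumes "web_roots A B V p" "z \<in> V"
  shows "3 * p i z ^ 2 + A z \<noteq> 0"
proof -
  have "3 * p i z ^ 2 + A z = (p i z - p (i + 1) z) * (p i z - p (i + 2) z)"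
    unfolding web_roots_vieta[OF assms, of i] by algebra
  then show ?thesis
    using web_roots_distinct[OF assms, of i "i + 1"] web_roots_distinct[OF assms, of i "i + 2"] by simp
qed

lemma web_roots_partials:
  assumes p: "web_roots A B V p" and V: "open V" "V \<subseteq> D" and A: "hol2 A D" and B: "hol2 B D" and z: "z \<in> V"
  shows "(3 * p i z ^ 2 + A z) * pdx (p i) z = - (pdx A z * p i z + pdx B z)"
    and "(3 * p i z ^ 2 + A z) * pdy (p i) z = - (pdy A z * p i z + pdy B z)"
proof -
  have zD: "z \<in> D" using V z by blast
  have hp: "hol2 (p i) V" using p by (simp add: web_roots_def)
  have zero: "has_partials (\<lambda>w. p i w ^ 3 + A w * p i w + B w) 0 0 z"
    by (rule has_partials_cong[OF has_partials_const[of 0] V(1) z]) (use p in \<open>simp add: web_roots_def\<close>)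
  have d: "has_partials (\<lambda>w. p i w ^ 3 + A w * p i w + B w)
     (of_nat 3 * p i z ^ (3 - 1) * pdx (p i) z + (pdx A z * p i z + A z * pdx (p i) z) + pdx B z)
     (of_nat 3 * p i z ^ (3 - 1) * pdy (p i) z + (pdy A z * p i z + A z * pdy (p i) z) + pdy B z) z"
    by (intro has_partials_intros hol2D[OF hp z] hol2D[OF A zD] hol2D[OF B zD])
  have "3 * p i z ^ 2 * pdx (p i) z + (pdx A z * p i z + A z * pdx (p i) z) + pdx B z = 0"
    using has_partials_pdx[OF zero] has_partials_pdx[OF d] by simp
  then show "(3 * p i z ^ 2 + A z) * pdx (p i) z = - (pdx A z * p i z + pdx B z)" by algebra
  have "3 * p i z ^ 2 * pdy (p i) z + (pdy A z * p i z + A z * pdy (p i) z) + pdy B z = 0"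
    using has_partials_pdy[OF zero] has_partials_pdy[OF d] by simp
  then show "(3 * p i z ^ 2 + A z) * pdy (p i) z = - (pdy A z * p i z + pdy B z)" by algebra
qed

text \<open>Implicit differentiation expresses \<open>P'\<close> as a fraction with denominator \<open>3P\<^sup>2 + a\<close>. Modulo the cubic
this denominator has the inverse \<open>(6aP\<^sup>2 - 9bP + 4a\<^sup>2) / (4a\<^sup>3 + 27b\<^sup>2)\<close>, so \<open>P'\<close> becomes a quadratic polynomial in \<open>P\<close>
with the discriminant as the only denominator.\<close>

lemma reduced_root_derivative:
  fixes P a b a' b' P' :: complex
  assumes root: "P ^ 3 + a * P + b = 0" and d: "(3 * P ^ 2 + a) * P' = - (a' * P + b')"
  shows "(4 * a ^ 3 + 27 * b ^ 2) * P' =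
    (9 * b * a' - 6 * a * b') * P ^ 2 + (2 * a ^ 2 * a' + 9 * b * b') * P + (6 * a * b * a' - 4 * a ^ 2 * b')"
proof -
  let ?K = "6 * a * P ^ 2 - 9 * b * P + 4 * a ^ 2"
  have "4 * a ^ 3 + 27 * b ^ 2 = (3 * P ^ 2 + a) * ?K" using root by algebra
  then have "(4 * a ^ 3 + 27 * b ^ 2) * P' = - (a' * P + b') * ?K" using d by algebra
  also have "\<dots> = (9 * b * a' - 6 * a * b') * P ^ 2 + (2 * a ^ 2 * a' + 9 * b * b') * P
      + (6 * a * b * a' - 4 * a ^ 2 * b')"
    using root by algebra
  finally show ?thesis .
qed

text \<open>The numerators of the coefficients of \<open>dx\<close> and \<open>dy\<close> in the Chern form over the common denominator
\<open>4A\<^sup>3 + 27B\<^sup>2\<close>.\<close>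

definition chern_x :: "(point \<Rightarrow> complex) \<Rightarrow> (point \<Rightarrow> complex) \<Rightarrow> point \<Rightarrow> complex" where
  "chern_x A B z = 2 * A z ^ 2 * pdx A z + 9 * B z * pdx B z + 6 * A z * B z * pdy A z - 4 * A z ^ 2 * pdy B z"

definition chern_y :: "(point \<Rightarrow> complex) \<Rightarrow> (point \<Rightarrow> complex) \<Rightarrow> point \<Rightarrow> complex" where
  "chern_y A B z = 4 * A z ^ 2 * pdy A z + 18 * B z * pdy B z - 9 * B z * pdx A z + 6 * A z * pdx B z"

lemma ext_d1_sigma:
  assumes p: "web_roots A B V p" and z: "z \<in> V"
  shows "ext_d1 (sigma p i) z = pdx (p (i + 1)) z - pdx (p (i + 2)) z
    + (pdy (p (i + 1)) z - pdy (p (i + 2)) z) * p i z + (p (i + 1) z - p (i + 2) z) * pdy (p i) z"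
proof -
  have hp: "has_partials (p j) (pdx (p j) z) (pdy (p j) z) z" for j
    using p z by (intro hol2D) (auto simp: web_roots_def)
  have "has_partials (\<lambda>w. (p (i + 1) w - p (i + 2) w) * - p i w)
     ((pdx (p (i + 1)) z - pdx (p (i + 2)) z) * - p i z + (p (i + 1) z - p (i + 2) z) * - pdx (p i) z)
     ((pdy (p (i + 1)) z - pdy (p (i + 2)) z) * - p i z + (p (i + 1) z - p (i + 2) z) * - pdy (p i) z) z"
    by (intro has_partials_intros hp)
  from has_partials_pdy[OF this] has_partials_pdx[OF has_partials_diff[OF hp hp], of "i + 1" "i + 2"]
  show ?thesis
    unfolding ext_d1_def sigma_def cscale_def fst_conv snd_conv mult_1_right by algebra
qed

text \<open>On the direction \<open>\<partial>\<^sub>x + p\<^sub>i \<partial>\<^sub>y\<close> of the \<open>i\<close>-th foliation the Chern form takes the value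
\<open>d\<sigma>\<^sub>i / (p\<^sub>i\<^sub>+\<^sub>1 - p\<^sub>i\<^sub>+\<^sub>2)\<close>, where \<open>d\<sigma>\<^sub>i\<close> stands for its coefficient. With the reduced derivatives of the
roots and \<open>p\<^sub>1 + p\<^sub>2 + p\<^sub>3 = 0\<close>, this value becomes affine in \<open>p\<^sub>i\<close>, with coefficients independent of \<open>i\<close>.\<close>

lemma ext_d1_sigma_eq_chern:
  assumes p: "web_roots A B V p" and V: "open V" "V \<subseteq> D" and A: "hol2 A D" and B: "hol2 B D" and z: "z \<in> V"
  shows "(4 * A z ^ 3 + 27 * B z ^ 2) * ext_d1 (sigma p i) z
    = (p (i + 1) z - p (i + 2) z) * (chern_x A B z + p i z * chern_y A B z)"
proof -
  have root: "p j z ^ 3 + A z * p j z + B z = 0" for j using p z by (simp add: web_roots_def)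
  note dx = reduced_root_derivative[OF root web_roots_partials(1)[OF assms]]
    and dy = reduced_root_derivative[OF root web_roots_partials(2)[OF assms]]
  have P: "p i z = - p (i + 1) z - p (i + 2) z" using web_roots_vieta(1)[OF p z, of i] by algebra
  show ?thesis
    unfolding ext_d1_sigma[OF p z] chern_x_def chern_y_def
    using dx[of "i + 1"] dx[of "i + 2"] dy[of "i + 1"] dy[of "i + 2"] dy[of i] P
    by algebra
qed

text \<open>A covector is determined by its values on two of the three leaf directions. The outcome contains
only the coefficients of the equation, so the Chern form extends over \<open>D\<close> with poles at most
along the discriminant curve.\<close>

lemma chern_form_eq:
  assumes p: "web_roots A B V p" and V: "open V" "V \<subseteq> D" and A: "hol2 A D" and B: "hol2 B D" and z: "z \<in> V"
  shows "chern_form p z =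
    (chern_x A B z / (4 * A z ^ 3 + 27 * B z ^ 2), chern_y A B z / (4 * A z ^ 3 + 27 * B z ^ 2))"
proof -
  define \<delta> where "\<delta> = 4 * A z ^ 3 + 27 * B z ^ 2"
  have \<delta>: "\<delta> \<noteq> 0" using discriminant_nonzero_at_web_roots[OF p z] by (simp add: \<delta>_def)
  define H1 H2 where "H1 = ext_d1 (sigma p 1) z" and "H2 = ext_d1 (sigma p 2) z"
  \<comment> \<open>Indices are taken modulo 3, so that \<open>2 + 2\<close> is \<open>1\<close>.\<close>
  have four: "p 4 = p 1" by (rule arg_cong[where f = p]) simp
  have ne: "p 1 z \<noteq> p 2 z" "p 2 z \<noteq> p 3 z" "p 3 z \<noteq> p 1 z"
    by (rule web_roots_distinct[OF p z]; simp)+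
  have H: "\<delta> * H1 = (p 2 z - p 3 z) * (chern_x A B z + p 1 z * chern_y A B z)"
    "\<delta> * H2 = (p 3 z - p 1 z) * (chern_x A B z + p 2 z * chern_y A B z)"
    using ext_d1_sigma_eq_chern[OF assms, of 1] ext_d1_sigma_eq_chern[OF assms, of 2]
    by (simp_all add: \<delta>_def H1_def H2_def four)
  have Om: "Omega p z = (p 2 z - p 3 z) * (p 3 z - p 1 z) * (p 2 z - p 1 z)"
    by (simp add: Omega_def det2_def sigma_def cscale_def four algebra_simps)
  then have Om0: "Omega p z \<noteq> 0" using ne by simp
  have "\<delta> * Omega p z * fst (chern_form p z)
      = \<delta> * (- H2 * (p 2 z - p 3 z) * p 1 z + H1 * (p 3 z - p 1 z) * p 2 z)"
    using Om0 by (simp add: chern_form_def chern_coeff_def sigma_def cscale_def four H1_def H2_def field_simps)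
  also have "\<dots> = Omega p z * chern_x A B z" unfolding Om using H by algebra
  finally have 1: "fst (chern_form p z) = chern_x A B z / \<delta>" using Om0 \<delta> by (simp add: field_simps)
  have "\<delta> * Omega p z * snd (chern_form p z)
      = \<delta> * (H2 * (p 2 z - p 3 z) - H1 * (p 3 z - p 1 z))"
    using Om0 by (simp add: chern_form_def chern_coeff_def sigma_def cscale_def four H1_def H2_def field_simps)
  also have "\<dots> = Omega p z * chern_y A B z" unfolding Om using H by algebra
  finally have 2: "snd (chern_form p z) = chern_y A B z / \<delta>" using Om0 \<delta> by (simp add: field_simps)
  from 1 2 show ?thesis by (simp add: prod_eq_iff \<delta>_def)
qed

section \<open>Closedness of the Chern form and existence of the factor\<close>

lemma hol2_chern:
  assumes "hol2 A D" "hol2 B D" "open D"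
  shows "hol2 (chern_x A B) D" "hol2 (chern_y A B) D"
  unfolding chern_x_def[abs_def] chern_y_def[abs_def]
  by (intro hol2_intros hol2_pdx hol2_pdy assms)+


text \<open>The curvature \<open>d\<gamma>\<close> multiplied by the square of the discriminant: the factor clears the denominators,
so that the result is holomorphic on all of \<open>D\<close> and the identity theorem applies to it.\<close>

definition curvature_numerator :: "(point \<Rightarrow> complex) \<Rightarrow> (point \<Rightarrow> complex) \<Rightarrow> point \<Rightarrow> complex" where
  "curvature_numerator A B z =
    (let \<delta> = (\<lambda>z. 4 * A z ^ 3 + 27 * B z ^ 2) in
     (pdx (chern_y A B) z * \<delta> z - chern_y A B z * pdx \<delta> z)
     - (pdy (chern_x A B) z * \<delta> z - chern_x A B z * pdy \<delta> z))"

lemma chern_curvature: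
  assumes A: "hol2 A D" and B: "hol2 B D" and D: "open D" and z: "z \<in> D" "4 * A z ^ 3 + 27 * B z ^ 2 \<noteq> 0"
  shows "pdx (\<lambda>z. chern_y A B z / (4 * A z ^ 3 + 27 * B z ^ 2)) z
      - pdy (\<lambda>z. chern_x A B z / (4 * A z ^ 3 + 27 * B z ^ 2)) z
    = curvature_numerator A B z / (4 * A z ^ 3 + 27 * B z ^ 2) ^ 2"
proof -
  have \<delta>: "hol2 (\<lambda>z. 4 * A z ^ 3 + 27 * B z ^ 2) D"
    by (intro hol2_intros A B)
  note d = has_partials_divide[OF hol2D[OF _ z(1)] hol2D[OF \<delta> z(1)] z(2)]
  show ?thesis
    unfolding has_partials_pdx[OF d[OF hol2_chern(2)[OF A B D]]] has_partials_pdy[OF d[OF hol2_chern(1)[OF A B D]]]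
    by (simp add: curvature_numerator_def Let_def diff_divide_distrib)
qed

text \<open>From \<open>dk = -k\<gamma>\<close>, the equality of the mixed derivatives of \<open>k\<close> reads \<open>k d\<gamma> = 0\<close>.\<close>

lemma curvature_vanishes_of_chern_factor:
  assumes p: "web_roots A B V p" and V: "open V" "V \<subseteq> D" and A: "hol2 A D" and B: "hol2 B D" and D: "open D"
    and k: "chern_factor p V k" and z: "z \<in> V"
  shows "curvature_numerator A B z = 0"
proof -
  define a where "a z = chern_x A B z / (4 * A z ^ 3 + 27 * B z ^ 2)" for z
  define b where "b z = chern_y A B z / (4 * A z ^ 3 + 27 * B z ^ 2)" for z
  have \<delta>: "4 * A z ^ 3 + 27 * B z ^ 2 \<noteq> 0" if "z \<in> V" for z
    using discriminant_nonzero_at_web_roots[OF p that] .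
  have "hol2 (\<lambda>z. 4 * A z ^ 3 + 27 * B z ^ 2) V"
    using V by (intro hol2_intros hol2_subset[OF A] hol2_subset[OF B])
  then have a: "hol2 a V" and b: "hol2 b V"
    unfolding a_def b_def using \<delta> hol2_chern[OF A B D] V(2)
    by (auto intro!: hol2_divide intro: hol2_subset)
  have hk: "hol2 k V" and k0: "k z \<noteq> 0" using k z by (auto simp: chern_factor_def)
  have dk: "pdx k w = - k w * a w" "pdy k w = - k w * b w" if "w \<in> V" for w
    using k that chern_form_eq[OF p V A B that] by (auto simp: chern_factor_def ext_d0_def cscale_def a_def b_def)
  have "pdx (pdy k) z = pdx (\<lambda>w. - k w * b w) z" by (rule pdx_cong[OF V(1) z dk(2)])
  also have "\<dots> = - pdx k z * b z + - k z * pdx b z"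
    by (rule has_partials_pdx[OF has_partials_mult[OF has_partials_minus[OF hol2D[OF hk z]] hol2D[OF b z]]])
  finally have 1: "pdx (pdy k) z = - pdx k z * b z + - k z * pdx b z" .
  have "pdy (pdx k) z = pdy (\<lambda>w. - k w * a w) z" by (rule pdy_cong[OF V(1) z dk(1)])
  also have "\<dots> = - pdy k z * a z + - k z * pdy a z"
    by (rule has_partials_pdy[OF has_partials_mult[OF has_partials_minus[OF hol2D[OF hk z]] hol2D[OF a z]]])
  finally have 2: "pdy (pdx k) z = - pdy k z * a z + - k z * pdy a z" .
  have "k z * (pdx b z - pdy a z) = 0"
    using pdx_pdy_commute[OF hk V(1) z] unfolding 1 2 dk[OF z] by algebra
  then have "pdx b z - pdy a z = 0" using k0 by simp
  then have "curvature_numerator A B z / (4 * A z ^ 3 + 27 * B z ^ 2) ^ 2 = 0"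
    using chern_curvature[OF A B D _ \<delta>[OF z]] z V(2) unfolding a_def[abs_def] b_def[abs_def] by auto
  then show ?thesis using \<delta>[OF z] by simp
qed

lemma hol2_curvature_numerator:
  assumes "hol2 A D" "hol2 B D" "open D"
  shows "hol2 (curvature_numerator A B) D"
  unfolding curvature_numerator_def[abs_def] Let_def
  by (intro hol2_intros hol2_pdx hol2_pdy hol2_chern assms)

lemma chern_factor_exists:
  assumes A: "hol2 A D" and B: "hol2 B D" and D: "open D" and q: "q \<in> D" "4 * A q ^ 3 + 27 * B q ^ 2 \<noteq> 0"
    and flat: "\<And>z. z \<in> D \<Longrightarrow> curvature_numerator A B z = 0"
  obtains V p k where "open V" "q \<in> V" "V \<subseteq> D" "web_roots A B V p" "chern_factor p V k"
proof -
  obtain N p where N: "open N" "q \<in> N" "N \<subseteq> D" "web_roots A B N p"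
    by (rule holomorphic_web_roots[OF A B D q])
  obtain r where r: "r > 0" "ball q r \<subseteq> N" using N(1,2) open_contains_ball by blast
  define V where "V = ball q r"
  have V: "open V" "V \<subseteq> D" "q \<in> V" using r N(3) by (auto simp: V_def)
  have p: "web_roots A B V p"
    using N(4) r(2) hol2_subset unfolding web_roots_def V_def by blast
  define a where "a z = chern_x A B z / (4 * A z ^ 3 + 27 * B z ^ 2)" for z
  define b where "b z = chern_y A B z / (4 * A z ^ 3 + 27 * B z ^ 2)" for z
  have \<delta>: "4 * A z ^ 3 + 27 * B z ^ 2 \<noteq> 0" if "z \<in> V" for z
    using discriminant_nonzero_at_web_roots[OF p that] .
  have "hol2 (\<lambda>z. 4 * A z ^ 3 + 27 * B z ^ 2) V"
    using V by (intro hol2_intros hol2_subset[OF A] hol2_subset[OF B])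
  then have ab: "hol2 a V" "hol2 b V"
    unfolding a_def b_def using \<delta> hol2_chern[OF A B D] V(2)
    by (auto intro!: hol2_divide intro: hol2_subset)
  have closed: "pdx b z = pdy a z" if "z \<in> V" for z
    using chern_curvature[OF A B D _ \<delta>[OF that]] flat[of z] that V(2)
    unfolding a_def[abs_def] b_def[abs_def] by auto
  define F where "F = radial_integral q a b"
  have F: "has_partials F (a z) (b z) z" if "z \<in> V" for z
    unfolding F_def using ab closed that unfolding V_def by (rule closed_form_primitive)
  define k where "k z = exp (- F z)" for z
  have k: "has_partials k (k z * - a z) (k z * - b z) z" if "z \<in> V" for z
    unfolding k_def[abs_def] by (intro has_partials_exp has_partials_minus F that)
  have "chern_factor p V k"
    unfolding chern_factor_def
  proof (intro conjI ballI)
    show "hol2 k V" by (rule hol2I) (rule k)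
    fix z assume z: "z \<in> V"
    show "k z \<noteq> 0" by (simp add: k_def)
    show "ext_d0 k z = cscale (- k z) (chern_form p z)"
      using has_partials_pdx[OF k[OF z]] has_partials_pdy[OF k[OF z]] chern_form_eq[OF p V(1,2) A B z]
      by (simp add: ext_d0_def cscale_def a_def b_def)
  qed
  with V p show ?thesis by (intro that)
qed

section \<open>Infinitesimal symmetries\<close>

text \<open>The value of \<open>k \<sigma>\<^sub>i\<close> on the vector field \<open>\<xi> \<partial>\<^sub>x + \<eta> \<partial>\<^sub>y\<close>. If \<open>u\<^sub>i\<close> is an abelian integral, this is the derivative
of \<open>u\<^sub>i\<close> along that vector field.\<close>

definition leaf_integral ::
    "(3 \<Rightarrow> point \<Rightarrow> complex) \<Rightarrow> (point \<Rightarrow> complex) \<Rightarrow> (point \<Rightarrow> complex) \<Rightarrow> (point \<Rightarrow> complex)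
     \<Rightarrow> 3 \<Rightarrow> point \<Rightarrow> complex" where
  "leaf_integral p k \<xi> \<eta> i z = k z * ((p (i + 1) z - p (i + 2) z) * (\<eta> z - p i z * \<xi> z))"

text \<open>The Lie derivative of \<open>dy - p\<^sub>i dx\<close> along \<open>\<xi> \<partial>\<^sub>x + \<eta> \<partial>\<^sub>y\<close>, evaluated on \<open>\<partial>\<^sub>x + p\<^sub>i \<partial>\<^sub>y\<close>. It vanishes
identically exactly when the vector field infinitesimally preserves the \<open>i\<close>-th foliation.\<close>

definition symmetry_defect ::
    "(3 \<Rightarrow> point \<Rightarrow> complex) \<Rightarrow> (point \<Rightarrow> complex) \<Rightarrow> (point \<Rightarrow> complex) \<Rightarrow> 3 \<Rightarrow> point \<Rightarrow> complex" where
  "symmetry_defect p \<xi> \<eta> i z = pdx \<eta> z + p i z * pdy \<eta> z - p i z * (pdx \<xi> z + p i z * pdy \<xi> z)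
     - (\<xi> z * pdx (p i) z + \<eta> z * pdy (p i) z)"

text \<open>By Cartan's formula the derivative of \<open>\<sigma>\<^sub>i(X)\<close> along a leaf differs from the value of the Lie derivative
\<open>L\<^sub>X \<sigma>\<^sub>i\<close> by a multiple of \<open>\<sigma>\<^sub>i(X)\<close>, namely by the value of \<open>\<gamma>\<close> on the leaf direction; the factor
\<open>k\<close> with \<open>dk = -k\<gamma>\<close> absorbs that term.\<close>

lemma leaf_integral_derivative:
  assumes p: "web_roots A B V p" and V: "open V" "V \<subseteq> D" and A: "hol2 A D" and B: "hol2 B D"
    and k: "chern_factor p V k" and \<xi>: "hol2 \<xi> D" and \<eta>: "hol2 \<eta> D" and z: "z \<in> V"
  shows "pdx (leaf_integral p k \<xi> \<eta> i) z + p i z * pdy (leaf_integral p k \<xi> \<eta> i) z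
    = k z * (p (i + 1) z - p (i + 2) z) * symmetry_defect p \<xi> \<eta> i z"
proof -
  have zD: "z \<in> D" using V z by blast
  have hp: "has_partials (p j) (pdx (p j) z) (pdy (p j) z) z" for j
    using p z by (intro hol2D) (auto simp: web_roots_def)
  have hk: "has_partials k (pdx k z) (pdy k z) z"
    using k z by (intro hol2D) (auto simp: chern_factor_def)
  have "has_partials (leaf_integral p k \<xi> \<eta> i)
    (pdx k z * ((p (i + 1) z - p (i + 2) z) * (\<eta> z - p i z * \<xi> z))
     + k z * ((pdx (p (i + 1)) z - pdx (p (i + 2)) z) * (\<eta> z - p i z * \<xi> z)
       + (p (i + 1) z - p (i + 2) z) * (pdx \<eta> z - (pdx (p i) z * \<xi> z + p i z * pdx \<xi> z))))
    (pdy k z * ((p (i + 1) z - p (i + 2) z) * (\<eta> z - p i z * \<xi> z))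
     + k z * ((pdy (p (i + 1)) z - pdy (p (i + 2)) z) * (\<eta> z - p i z * \<xi> z)
       + (p (i + 1) z - p (i + 2) z) * (pdy \<eta> z - (pdy (p i) z * \<xi> z + p i z * pdy \<xi> z)))) z"
    unfolding leaf_integral_def[abs_def]
    by (intro has_partials_intros hp hk hol2D[OF \<xi> zD] hol2D[OF \<eta> zD])
  note w = has_partials_pdx[OF this] has_partials_pdy[OF this]
  define \<delta> where "\<delta> = 4 * A z ^ 3 + 27 * B z ^ 2"
  have \<delta>: "\<delta> \<noteq> 0" using discriminant_nonzero_at_web_roots[OF p z] by (simp add: \<delta>_def)
  have "pdx k z = - k z * (chern_x A B z / \<delta>)" "pdy k z = - k z * (chern_y A B z / \<delta>)"
    using k z chern_form_eq[OF p V A B z] by (auto simp: chern_factor_def ext_d0_def cscale_def \<delta>_def)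
  then have "\<delta> * pdx k z = - k z * chern_x A B z" "\<delta> * pdy k z = - k z * chern_y A B z"
    using \<delta> by simp_all
  then have "\<delta> * ((pdx k z + p i z * pdy k z) * (p (i + 1) z - p (i + 2) z)) = \<delta> * (- k z * ext_d1 (sigma p i) z)"
    using ext_d1_sigma_eq_chern[OF p V A B z, of i] unfolding \<delta>_def[symmetric] by algebra
  then have "(pdx k z + p i z * pdy k z) * (p (i + 1) z - p (i + 2) z) = - k z * ext_d1 (sigma p i) z"
    using \<delta> by (simp only: mult_cancel_left) simp
  then show ?thesis
    unfolding w symmetry_defect_def ext_d1_sigma[OF p z] by algebra
qed

text \<open>The determining equations of point symmetries: the coefficients of \<open>p\<^sup>0\<close>, \<open>p\<^sup>1\<close>, \<open>p\<^sup>2\<close> in the invariance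
condition of \<open>p\<^sup>3 + A p + B = 0\<close> under the prolonged vector field, reduced modulo the cubic.\<close>

definition determining ::
    "(point \<Rightarrow> complex) \<Rightarrow> (point \<Rightarrow> complex) \<Rightarrow> (point \<Rightarrow> complex) \<Rightarrow> (point \<Rightarrow> complex)
     \<Rightarrow> nat \<Rightarrow> point \<Rightarrow> complex" where
  "determining A B \<xi> \<eta> n z =
    (if n = 0 then A z * pdx \<eta> z - 3 * B z * (pdy \<eta> z - pdx \<xi> z) + vf_apply \<xi> \<eta> B z
     else if n = 1 then 3 * B z * pdy \<xi> z - 2 * A z * (pdy \<eta> z - pdx \<xi> z) + vf_apply \<xi> \<eta> A z
     else 3 * pdx \<eta> z + 2 * A z * pdy \<xi> z)"

text \<open>Multiplying by \<open>3p\<^sub>i\<^sup>2 + A\<close>, the derivative of the cubic at its root, removes the derivatives of \<open>p\<^sub>i\<close>; the powers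
\<open>p\<^sub>i\<^sup>3\<close> and \<open>p\<^sub>i\<^sup>4\<close> that arise are then reduced by the cubic.\<close>

lemma symmetry_defect_eq:
  assumes p: "web_roots A B V p" and V: "open V" "V \<subseteq> D" and A: "hol2 A D" and B: "hol2 B D" and z: "z \<in> V"
  shows "(3 * p i z ^ 2 + A z) * symmetry_defect p \<xi> \<eta> i z
    = determining A B \<xi> \<eta> 0 z + determining A B \<xi> \<eta> 1 z * p i z + determining A B \<xi> \<eta> 2 z * p i z ^ 2"
proof -
  have root: "p i z ^ 3 + A z * p i z + B z = 0" using p z by (simp add: web_roots_def)
  show ?thesis
    unfolding symmetry_defect_def
    using root web_roots_partials[OF assms, of i]
    by (simp add: determining_def vf_apply_def) algebra
qed

lemma quadratic_three_roots:
  fixes a b c :: complex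
  assumes "a + b * x + c * x ^ 2 = 0" "a + b * y + c * y ^ 2 = 0" "a + b * z + c * z ^ 2 = 0"
    and "x \<noteq> y" "y \<noteq> z" "z \<noteq> x"
  shows "a = 0" "b = 0" "c = 0"
proof -
  have "(x - y) * (b + c * (x + y)) = 0" "(y - z) * (b + c * (y + z)) = 0"
    using assms(1-3) by algebra+
  then have bc: "b + c * (x + y) = 0" "b + c * (y + z) = 0" using assms by auto
  then have "(z - x) * c = 0" by algebra
  then show "c = 0" using assms by simp
  with bc show "b = 0" by simp
  with \<open>c = 0\<close> assms(1) show "a = 0" by simp
qed



lemma hol2_determining:
  assumes "hol2 A D" "hol2 B D" "hol2 \<xi> D" "hol2 \<eta> D" "open D"
  shows "hol2 (determining A B \<xi> \<eta> n) D"
proof -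
  have "hol2 (\<lambda>z. determining A B \<xi> \<eta> n z) D"
    unfolding determining_def vf_apply_def
    by (cases "n = 0"; cases "n = 1"; simp; intro hol2_intros hol2_pdx hol2_pdy assms)
  then show ?thesis .
qed

text \<open>Over the chart \<open>\<sigma>\<^sub>i(X)\<close> times \<open>k\<close> equals \<open>C u\<^sub>i + c\<^sub>i\<close>, which is constant along the \<open>i\<close>-th foliation because
\<open>du\<^sub>i = k \<sigma>\<^sub>i\<close>. So the three defects vanish, and the quadratic polynomial with the determining
functions as coefficients has three distinct roots.\<close>

lemma determining_vanishes_on_chart:
  assumes p: "web_roots A B V p" and V: "open V" "V \<subseteq> D" and A: "hol2 A D" and B: "hol2 B D"
    and k: "chern_factor p V k" and u: "abelian_integrals p V k u" and \<xi>: "hol2 \<xi> D" and \<eta>: "hol2 \<eta> D"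
    and X: "\<And>i z. z \<in> V \<Longrightarrow> vf_apply \<xi> \<eta> (u i) z = C * u i z + c i"
    and z: "z \<in> V" and n: "n < 3"
  shows "determining A B \<xi> \<eta> n z = 0"
proof -
  have "symmetry_defect p \<xi> \<eta> i z = 0" for i
  proof -
    have du: "pdx (u i) w = k w * ((p (i + 1) w - p (i + 2) w) * - p i w)"
      "pdy (u i) w = k w * (p (i + 1) w - p (i + 2) w)" if "w \<in> V" for w
      using u that by (auto simp: abelian_integrals_def ext_d0_def cscale_def sigma_def)
    have eq: "C * u i w + c i = leaf_integral p k \<xi> \<eta> i w" if "w \<in> V" for w
      using X[OF that, of i] du[OF that] by (simp add: leaf_integral_def vf_apply_def algebra_simps)
    have "hol2 (u i) V" using u by (simp add: abelian_integrals_def)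
    then have "has_partials (\<lambda>w. C * u i w + c i)
        (0 * u i z + C * pdx (u i) z + 0) (0 * u i z + C * pdy (u i) z + 0) z"
      by (intro has_partials_intros hol2D[of _ V] z)
    then have "has_partials (leaf_integral p k \<xi> \<eta> i)
        (0 * u i z + C * pdx (u i) z + 0) (0 * u i z + C * pdy (u i) z + 0) z"
      by (rule has_partials_cong[OF _ V(1) z eq])
    from has_partials_pdx[OF this] has_partials_pdy[OF this]
    have "pdx (leaf_integral p k \<xi> \<eta> i) z + p i z * pdy (leaf_integral p k \<xi> \<eta> i) z = 0"
      unfolding du[OF z] by algebra
    then have "k z * (p (i + 1) z - p (i + 2) z) * symmetry_defect p \<xi> \<eta> i z = 0"
      using leaf_integral_derivative[OF p V A B k \<xi> \<eta> z, of i] by simp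
    moreover have "k z \<noteq> 0" using k z by (simp add: chern_factor_def)
    moreover have "p (i + 1) z \<noteq> p (i + 2) z" by (rule web_roots_distinct[OF p z]) simp
    ultimately show ?thesis by simp
  qed
  then have quad: "determining A B \<xi> \<eta> 0 z + determining A B \<xi> \<eta> 1 z * p i z
      + determining A B \<xi> \<eta> 2 z * p i z ^ 2 = 0" for i
    using symmetry_defect_eq[OF p V A B z, of i \<xi> \<eta>] by simp
  have ne: "p 1 z \<noteq> p 2 z" "p 2 z \<noteq> p 3 z" "p 3 z \<noteq> p 1 z"
    by (rule web_roots_distinct[OF p z]; simp)+
  from n consider "n = 0" | "n = 1" | "n = 2" by linarith
  then show ?thesis
    using quadratic_three_roots[OF quad[of 1] quad[of 2] quad[of 3] ne] by cases auto
qed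

lemma symmetry_defect_vanishes:
  assumes p: "web_roots A B V p" and V: "open V" "V \<subseteq> D" and A: "hol2 A D" and B: "hol2 B D"
    and zero: "\<And>n z. n < 3 \<Longrightarrow> z \<in> D \<Longrightarrow> determining A B \<xi> \<eta> n z = 0" and z: "z \<in> V"
  shows "symmetry_defect p \<xi> \<eta> i z = 0"
proof -
  have "z \<in> D" using V z by blast
  then have "(3 * p i z ^ 2 + A z) * symmetry_defect p \<xi> \<eta> i z = 0"
    unfolding symmetry_defect_eq[OF p V A B z] using zero[of _ z] by simp
  then show ?thesis using simple_at_web_roots[OF p z] by simp
qed

section \<open>The first integrals and their cubic equation\<close>

lemma first_integral_leaf_integral_square:
  assumes p: "web_roots A B V p" and V: "open V" "V \<subseteq> D" and A: "hol2 A D" and B: "hol2 B D"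
    and k: "chern_factor p V k" and \<xi>: "hol2 \<xi> D" and \<eta>: "hol2 \<eta> D"
    and zero: "\<And>n z. n < 3 \<Longrightarrow> z \<in> D \<Longrightarrow> determining A B \<xi> \<eta> n z = 0"
  shows "first_integral (p i) V (\<lambda>z. leaf_integral p k \<xi> \<eta> i z ^ 2)"
proof (rule first_integralI)
  have hp: "hol2 (p j) V" for j using p by (simp add: web_roots_def)
  have "hol2 (\<lambda>z. leaf_integral p k \<xi> \<eta> i z) V"
    unfolding leaf_integral_def using k
    by (intro hol2_intros hp hol2_subset[OF \<xi> V(2)] hol2_subset[OF \<eta> V(2)]) (simp add: chern_factor_def)
  then have w: "hol2 (leaf_integral p k \<xi> \<eta> i) V" .
  then show "hol2 (\<lambda>z. leaf_integral p k \<xi> \<eta> i z ^ 2) V" by (rule hol2_power)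
  fix z assume z: "z \<in> V"
  have "pdx (leaf_integral p k \<xi> \<eta> i) z + p i z * pdy (leaf_integral p k \<xi> \<eta> i) z = 0"
    unfolding leaf_integral_derivative[OF p V A B k \<xi> \<eta> z]
    using symmetry_defect_vanishes[OF p V A B zero z] by simp
  moreover note has_partials_power[OF hol2D[OF w z], of 2]
  note has_partials_pdx[OF this] has_partials_pdy[OF this]
  ultimately show "pdx (\<lambda>z. leaf_integral p k \<xi> \<eta> i z ^ 2) z + p i z * pdy (\<lambda>z. leaf_integral p k \<xi> \<eta> i z ^ 2) z = 0"
    by (simp add: algebra_simps) algebra
qed

text \<open>The numbers \<open>w\<^sub>i = (p\<^sub>i\<^sub>+\<^sub>1 - p\<^sub>i\<^sub>+\<^sub>2)(\<eta> - p\<^sub>i \<xi>)\<close> sum to zero, their second elementary symmetric function is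
\<open>-\<alpha>\<close>, and the square of their product is \<open>-\<beta>\<close>: the differences of roots contribute minus the
expression \<open>4A\<^sup>3 + 27B\<^sup>2\<close>, and the product of the \<open>\<eta> - p\<^sub>i \<xi>\<close> is the homogenised cubic evaluated at \<open>(\<xi>, \<eta>)\<close>.\<close>

lemma cubic_of_squares:
  assumes p: "web_roots A B V p" and z: "z \<in> V"
    and U: "\<And>i. U i = ((p (i + 1) z - p (i + 2) z) * (\<eta> - p i z * \<xi>)) ^ 2"
    and \<alpha>: "\<alpha> = \<xi> ^ 2 * A z ^ 2 - 3 * \<eta> ^ 2 * A z - 9 * \<xi> * \<eta> * B z"
    and \<beta>: "\<beta> = (4 * A z ^ 3 + 27 * B z ^ 2) * (\<eta> ^ 3 + \<xi> ^ 2 * \<eta> * A z + \<xi> ^ 3 * B z) ^ 2"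
  shows "T ^ 3 - 2 * \<alpha> * T ^ 2 + \<alpha> ^ 2 * T + \<beta> = (T - U 1) * (T - U 2) * (T - U 3)"
proof -
  have four: "p 4 = p 1" and five: "p 5 = p 2" by (rule arg_cong[where f = p], simp)+
  define w1 where "w1 = (p 2 z - p 3 z) * (\<eta> - p 1 z * \<xi>)"
  define w2 where "w2 = (p 3 z - p 1 z) * (\<eta> - p 2 z * \<xi>)"
  define w3 where "w3 = (p 1 z - p 2 z) * (\<eta> - p 3 z * \<xi>)"
  have U': "U 1 = w1 ^ 2" "U 2 = w2 ^ 2" "U 3 = w3 ^ 2"
    by (simp_all add: U w1_def w2_def w3_def four five)
  have w3: "w3 = - w1 - w2" unfolding w1_def w2_def w3_def by algebra
  have p3: "p 3 z = - p 1 z - p 2 z" and A: "A z = - (p 1 z ^ 2 + p 1 z * p 2 z + p 2 z ^ 2)"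
    and B: "B z = p 1 z * p 2 z * (p 1 z + p 2 z)"
    using web_roots_vieta[OF p z, of 1] by simp_all
  have "\<alpha> = w1 ^ 2 + w1 * w2 + w2 ^ 2"
    unfolding \<alpha> w1_def w2_def A B p3 by algebra
  moreover have "\<beta> = - ((w1 * w2 * w3) ^ 2)"
  proof -
    have "4 * A z ^ 3 + 27 * B z ^ 2 = - (((p 1 z - p 2 z) * (p 2 z - p 3 z) * (p 3 z - p 1 z)) ^ 2)"
      using discriminant_at_web_roots[OF p z, of 1] by simp
    moreover have "\<eta> ^ 3 + \<xi> ^ 2 * \<eta> * A z + \<xi> ^ 3 * B z = (\<eta> - p 1 z * \<xi>) * (\<eta> - p 2 z * \<xi>) * (\<eta> - p 3 z * \<xi>)"
      unfolding A B p3 by algebra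
    ultimately show ?thesis unfolding \<beta> w1_def w2_def w3_def by algebra
  qed
  ultimately show ?thesis unfolding U' w3 by algebra
qed

theorem theorem1:
  fixes A B \<xi> \<eta> :: "complex \<times> complex \<Rightarrow> complex"
    and D V\<^sub>0 :: "(complex \<times> complex) set"
    and p\<^sub>0 u\<^sub>0 :: "3 \<Rightarrow> complex \<times> complex \<Rightarrow> complex"
    and k\<^sub>0 :: "complex \<times> complex \<Rightarrow> complex"
    and C :: complex and c :: "3 \<Rightarrow> complex"
  assumes "open D" and "connected D"
    and "hol2 A D" and "hol2 B D"
    and "\<exists>z\<in>D. 4 * A z ^ 3 + 27 * B z ^ 2 \<noteq> 0"
    and "flat_web A B D"
    and "web_symmetry A B D \<xi> \<eta>"
    and "open V\<^sub>0" and "V\<^sub>0 \<noteq> {}" and "V\<^sub>0 \<subseteq> D"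
    and "web_roots A B V\<^sub>0 p\<^sub>0" and "chern_factor p\<^sub>0 V\<^sub>0 k\<^sub>0" and "abelian_integrals p\<^sub>0 V\<^sub>0 k\<^sub>0 u\<^sub>0"
    and "\<forall>i. \<forall>z\<in>V\<^sub>0. vf_apply \<xi> \<eta> (u\<^sub>0 i) z = C * u\<^sub>0 i z + c i"
    and "C \<noteq> 0"
  shows "\<forall>q \<in> D - discriminant_curve A B.
    (\<exists>V p k. open V \<and> q \<in> V \<and> V \<subseteq> D \<and> web_roots A B V p \<and> chern_factor p V k) \<and>
    (\<forall>V p k. open V \<and> q \<in> V \<and> V \<subseteq> D \<and> web_roots A B V p \<and> chern_factor p V k \<longrightarrow>
      (\<exists>W I U. open W \<and> q \<in> W \<and> W \<subseteq> V \<and>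
        (\<forall>i. first_integral (p i) W (I i)) \<and>
        (\<forall>z\<in>W. \<forall>i. I i z = k z ^ 2 * U i z) \<and>
        (\<forall>z\<in>W.
          let \<alpha> = \<xi> z ^ 2 * A z ^ 2 - 3 * \<eta> z ^ 2 * A z - 9 * \<xi> z * \<eta> z * B z;
              \<beta> = (4 * A z ^ 3 + 27 * B z ^ 2) *
                    (\<eta> z ^ 3 + \<xi> z ^ 2 * \<eta> z * A z + \<xi> z ^ 3 * B z) ^ 2
          in \<forall>T. T ^ 3 - 2 * \<alpha> * T ^ 2 + \<alpha> ^ 2 * T + \<beta> =
                (T - U 1 z) * (T - U 2 z) * (T - U 3 z))))"
proof -
  note D = \<open>open D\<close> and A = \<open>hol2 A D\<close> and B = \<open>hol2 B D\<close>
    and p\<^sub>0 = \<open>web_roots A B V\<^sub>0 p\<^sub>0\<close> and k\<^sub>0 = \<open>chern_factor p\<^sub>0 V\<^sub>0 k\<^sub>0\<close>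
  note V\<^sub>0 = \<open>open V\<^sub>0\<close> \<open>V\<^sub>0 \<noteq> {}\<close> \<open>V\<^sub>0 \<subseteq> D\<close>
  have \<xi>: "hol2 \<xi> D" and \<eta>: "hol2 \<eta> D"
    using \<open>web_symmetry A B D \<xi> \<eta>\<close> by (auto simp: web_symmetry_def)
  have flat: "curvature_numerator A B z = 0" if "z \<in> D" for z
    using hol2_identity[OF hol2_curvature_numerator[OF A B D] D \<open>connected D\<close> V\<^sub>0 _ that]
      curvature_vanishes_of_chern_factor[OF p\<^sub>0 V\<^sub>0(1,3) A B D k\<^sub>0] by blast
  have zero: "determining A B \<xi> \<eta> n z = 0" if "n < 3" "z \<in> D" for n z
    using hol2_identity[OF hol2_determining[OF A B \<xi> \<eta> D] D \<open>connected D\<close> V\<^sub>0 _ that(2)]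
      determining_vanishes_on_chart[OF p\<^sub>0 V\<^sub>0(1,3) A B k\<^sub>0 \<open>abelian_integrals p\<^sub>0 V\<^sub>0 k\<^sub>0 u\<^sub>0\<close> \<xi> \<eta>] that(1)
      \<open>\<forall>i. \<forall>z\<in>V\<^sub>0. vf_apply \<xi> \<eta> (u\<^sub>0 i) z = C * u\<^sub>0 i z + c i\<close> by blast
  show ?thesis
  proof (intro ballI conjI allI impI)
    fix q assume "q \<in> D - discriminant_curve A B"
    then have q: "q \<in> D" "4 * A q ^ 3 + 27 * B q ^ 2 \<noteq> 0" by (auto simp: discriminant_curve_def)
    show "\<exists>V p k. open V \<and> q \<in> V \<and> V \<subseteq> D \<and> web_roots A B V p \<and> chern_factor p V k"
      by (rule chern_factor_exists[OF A B D q flat]) blast+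
  next
    fix q V p k
    assume "open V \<and> q \<in> V \<and> V \<subseteq> D \<and> web_roots A B V p \<and> chern_factor p V k"
    then have V: "open V" "V \<subseteq> D" "q \<in> V" and p: "web_roots A B V p" and k: "chern_factor p V k" by auto
    define U where "U i z = ((p (i + 1) z - p (i + 2) z) * (\<eta> z - p i z * \<xi> z)) ^ 2" for i z
    show "\<exists>W I U. open W \<and> q \<in> W \<and> W \<subseteq> V \<and>
        (\<forall>i. first_integral (p i) W (I i)) \<and>
        (\<forall>z\<in>W. \<forall>i. I i z = k z ^ 2 * U i z) \<and>
        (\<forall>z\<in>W.
          let \<alpha> = \<xi> z ^ 2 * A z ^ 2 - 3 * \<eta> z ^ 2 * A z - 9 * \<xi> z * \<eta> z * B z;
              \<beta> = (4 * A z ^ 3 + 27 * B z ^ 2) *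
                    (\<eta> z ^ 3 + \<xi> z ^ 2 * \<eta> z * A z + \<xi> z ^ 3 * B z) ^ 2
          in \<forall>T. T ^ 3 - 2 * \<alpha> * T ^ 2 + \<alpha> ^ 2 * T + \<beta> =
                (T - U 1 z) * (T - U 2 z) * (T - U 3 z))"
    proof (rule exI[of _ V], rule exI[of _ "\<lambda>i z. leaf_integral p k \<xi> \<eta> i z ^ 2"],
        rule exI[of _ U], unfold Let_def, intro conjI ballI allI)
      show "first_integral (p i) V (\<lambda>z. leaf_integral p k \<xi> \<eta> i z ^ 2)" for i
        by (rule first_integral_leaf_integral_square[OF p V(1,2) A B k \<xi> \<eta> zero])
      show "leaf_integral p k \<xi> \<eta> i z ^ 2 = k z ^ 2 * U i z" for i z
        by (simp add: leaf_integral_def U_def power_mult_distrib)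
    qed (rule V order_refl | erule cubic_of_squares[OF p _ U_def refl refl])+
  qed
qed

end
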